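(* Let $D=\mathrm{Div}(\mathbf V)$ be the infinite-variable divided power algebra over $k$, let $I_0=(0)$, for each integer $r\ge 1$ let $I_r\subset D$ be the $\mathrm{GL}$-stable ideal generated by the positive-degree elements of degree $\le p^{r-1}$, and let $I_\infty$ be the homogeneous maximal ideal of $D$. Let $\overline{\mathbf N}=\mathbf N\cup\{\infty\}$ carry the right-order topology, i.e. the topology whose nonempty closed sets are the sets $[n,\infty)\cup\{\infty\}$ with $n\in\overline{\mathbf N}$. Then the map $\overline{\mathbf N}\ni n\mapsto I_n\in \mathrm{Spec}_{\mathrm{GL}}(D)$ is a homeomorphism from $\overline{\mathbf N}$ to the $\mathrm{GL}$-spectrum of $D$.
   Context: $k$ is an algebraically closed field of characteristic $p>0$; $\mathbf N=\{0,1,2,\dots\}$. $\mathbf V$ is the $k$-vector space with basis $\{x_i\}_{i\ge 1}$ and $\mathrm{GL}$ is the group of automorphisms of $\mathbf V$ fixing all but finitely many $x_i$. A polynomial representation of $\mathrm{GL}$ is a subquotient of a (possibly infinite) direct sum of tensor powers $\mathbf V^{\otimes d}$; it is graded by degree. A $\mathrm{GL}$-algebra is a commutative $k$-algebra with an action of $\mathrm{GL}$ by algebra automorphisms making it a polynomial representation. $D=\mathrm{Div}(\mathbf V)$ is the commutative $k$-algebra generated by $x_i^{[t]}$ ($i,t\ge 1$) with relations $x_i^{[t]}x_i^{[s]}=\binom{t+s}{s}x_i^{[t+s]}$, graded by $\deg x_i^{[t]}=t$, with its natural $\mathrm{GL}$-action $g\cdot x_i^{[t]}=(gx_i)^{[t]}$,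 where $(\sum_j c_jx_j)^{[t]}=\sum_{\sum t_j=t}\prod_j c_j^{t_j}x_j^{[t_j]}$ (with $x_j^{[0]}=1$). For a $\mathrm{GL}$-algebra $A$, an ideal means a $\mathrm{GL}$-stable ideal. A proper ideal $\mathfrak p\subset A$ is $\mathrm{GL}$-prime if for all ($\mathrm{GL}$-stable) ideals $\mathfrak a,\mathfrak b$ with $\mathfrak a\mathfrak b\subset\mathfrak p$, one of $\mathfrak a,\mathfrak b$ is contained in $\mathfrak p$. $\mathrm{Spec}_{\mathrm{GL}}(A)$ is the set of $\mathrm{GL}$-prime ideals with the Zariski topology (closed sets $\{\mathfrak p:\mathfrak p\supseteq\mathfrak a\}$ for $\mathfrak a$ a $\mathrm{GL}$-stable ideal). *)

theory Defs
  imports "HOL-Analysis.Abstract_Topology" "HOL-Library.Extended_Nat" "HOL-Library.Poly_Mapping"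
    "HOL-Computational_Algebra.Polynomial"
begin

section \<open>Polynomials in arbitrarily many variables\<close>

type_synonym ('v, 'k) mpoly = "('v \<Rightarrow>\<^sub>0 nat) \<Rightarrow>\<^sub>0 'k"

definition mpoly_const :: "'k::comm_ring_1 \<Rightarrow> ('v, 'k) mpoly" where
  "mpoly_const c = Poly_Mapping.single 0 c"

definition mpoly_var :: "'v \<Rightarrow> ('v, 'k::comm_ring_1) mpoly" where
  "mpoly_var v = Poly_Mapping.single (Poly_Mapping.single v 1) 1"

definition mpoly_eval ::
  "('k::comm_ring_1 \<Rightarrow> 'b::comm_ring_1) \<Rightarrow> ('v \<Rightarrow> 'b) \<Rightarrow> ('v, 'k) mpoly \<Rightarrow> 'b" where
  "mpoly_eval c \<sigma> f =
     (\<Sum>m\<in>Poly_Mapping.keys f. c (Poly_Mapping.lookup f m) *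
        (\<Prod>v\<in>Poly_Mapping.keys m. \<sigma> v ^ Poly_Mapping.lookup m v))"

definition unital_hom :: "('a::comm_ring_1 \<Rightarrow> 'b::comm_ring_1) \<Rightarrow> bool" where
  "unital_hom h \<longleftrightarrow> h 1 = 1 \<and> (\<forall>x y. h (x + y) = h x + h y) \<and> (\<forall>x y. h (x * y) = h x * h y)"

lemma unital_hom_zero: "unital_hom h \<Longrightarrow> h 0 = 0"
  unfolding unital_hom_def by (metis add.right_neutral add_left_cancel)

lemma unital_hom_uminus: "unital_hom h \<Longrightarrow> h (- x) = - h x"
proof -
  assume h: "unital_hom h"
  have "h (- x) + h x = h (- x + x)" using h unfolding unital_hom_def by metis
  then show ?thesis using unital_hom_zero[OF h] by (simp add: eq_neg_iff_add_eq_0)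
qed

lemma unital_hom_diff: "unital_hom h \<Longrightarrow> h (x - y) = h x - h y"
proof -
  assume h: "unital_hom h"
  have "h (x + - y) = h x + h (- y)" using h unfolding unital_hom_def by blast
  then show ?thesis using unital_hom_uminus[OF h] by simp
qed

lemma unital_hom_sum: "unital_hom h \<Longrightarrow> h (sum f A) = (\<Sum>x\<in>A. h (f x))"
  by (induction A rule: infinite_finite_induct) (auto simp: unital_hom_zero unital_hom_def)

lemma unital_hom_of_nat: "unital_hom h \<Longrightarrow> h (of_nat n) = of_nat n"
  by (induction n) (auto simp: unital_hom_zero unital_hom_def)

definition monom_val :: "('v \<Rightarrow> 'b::comm_ring_1) \<Rightarrow> ('v \<Rightarrow>\<^sub>0 nat) \<Rightarrow> 'b" where
  "monom_val \<sigma> m = (\<Prod>v\<in>Poly_Mapping.keys m. \<sigma> v ^ Poly_Mapping.lookup m v)"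

lemma monom_val_superset:
  assumes "finite S" "Poly_Mapping.keys m \<subseteq> S"
  shows "monom_val \<sigma> m = (\<Prod>v\<in>S. \<sigma> v ^ Poly_Mapping.lookup m v)"
  unfolding monom_val_def using assms
  by (intro prod.mono_neutral_left) (auto simp: in_keys_iff)

lemma monom_val_add: "monom_val \<sigma> (m + n) = monom_val \<sigma> m * monom_val \<sigma> n"
proof -
  let ?S = "Poly_Mapping.keys m \<union> Poly_Mapping.keys n"
  have f: "finite ?S" by simp
  have "Poly_Mapping.keys (m + n) \<subseteq> ?S" by (rule Poly_Mapping.keys_add)
  then show ?thesis
    using monom_val_superset[OF f, of "m + n" \<sigma>] monom_val_superset[OF f, of m \<sigma>]
      monom_val_superset[OF f, of n \<sigma>]
    by (simp add: lookup_add power_add prod.distrib)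
qed

lemma mpoly_eval_superset:
  assumes "c 0 = 0" "finite S" "Poly_Mapping.keys f \<subseteq> S"
  shows "mpoly_eval c \<sigma> f = (\<Sum>m\<in>S. c (Poly_Mapping.lookup f m) * monom_val \<sigma> m)"
  unfolding mpoly_eval_def monom_val_def[symmetric] using assms
  by (intro sum.mono_neutral_left) (auto simp: in_keys_iff)

lemma mpoly_eval_single:
  "c 0 = 0 \<Longrightarrow> mpoly_eval c \<sigma> (Poly_Mapping.single m a) = c a * monom_val \<sigma> m"
  by (subst mpoly_eval_superset[where S = "{m}"]) auto

lemma mpoly_eval_add:
  assumes "unital_hom c"
  shows "mpoly_eval c \<sigma> (f + g) = mpoly_eval c \<sigma> f + mpoly_eval c \<sigma> g"
proof -
  let ?S = "Poly_Mapping.keys f \<union> Poly_Mapping.keys g"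
  have S: "c 0 = 0" "finite ?S" using unital_hom_zero[OF assms] by auto
  have "Poly_Mapping.keys (f + g) \<subseteq> ?S" by (rule Poly_Mapping.keys_add)
  then show ?thesis
    using mpoly_eval_superset[where c = c, OF S, of f \<sigma>] mpoly_eval_superset[where c = c, OF S, of g \<sigma>]
      mpoly_eval_superset[where c = c, OF S, of "f + g" \<sigma>] assms
    by (simp add: lookup_add unital_hom_def ring_distribs sum.distrib)
qed

lemma mpoly_sum_singles:
  "f = (\<Sum>m\<in>Poly_Mapping.keys f. Poly_Mapping.single m (Poly_Mapping.lookup f m))"
  by (rule poly_mapping_eqI)
    (auto simp: lookup_sum lookup_single when_def in_keys_iff)

lemma mpoly_eval_sum:
  assumes "unital_hom c"
  shows "mpoly_eval c \<sigma> (sum F A) = (\<Sum>a\<in>A. mpoly_eval c \<sigma> (F a))"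
  by (induction A rule: infinite_finite_induct)
    (auto simp: mpoly_eval_add[OF assms], auto simp: mpoly_eval_def)

lemma mpoly_eval_mult:
  assumes "unital_hom c"
  shows "mpoly_eval c \<sigma> (f * g) = mpoly_eval c \<sigma> f * mpoly_eval c \<sigma> g"
proof -
  let ?t = "\<lambda>f m. Poly_Mapping.single m (Poly_Mapping.lookup f m)"
  note z = unital_hom_zero[OF assms]
  have "f * g = (\<Sum>m\<in>Poly_Mapping.keys f. \<Sum>n\<in>Poly_Mapping.keys g. ?t f m * ?t g n)"
    by (subst mpoly_sum_singles[of f], subst mpoly_sum_singles[of g]) (simp add: sum_product)
  then have "mpoly_eval c \<sigma> (f * g)
      = (\<Sum>m\<in>Poly_Mapping.keys f. \<Sum>n\<in>Poly_Mapping.keys g. mpoly_eval c \<sigma> (?t f m * ?t g n))"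
    by (simp add: mpoly_eval_sum[OF assms])
  also have "\<dots> = (\<Sum>m\<in>Poly_Mapping.keys f. \<Sum>n\<in>Poly_Mapping.keys g.
      mpoly_eval c \<sigma> (?t f m) * mpoly_eval c \<sigma> (?t g n))"
    using assms by (simp add: mult_single mpoly_eval_single[where c = c, OF z] monom_val_add
      unital_hom_def mult_ac)
  also have "\<dots> = mpoly_eval c \<sigma> f * mpoly_eval c \<sigma> g"
    by (subst (3) mpoly_sum_singles[of f], subst (3) mpoly_sum_singles[of g])
      (simp add: mpoly_eval_sum[OF assms] sum_product)
  finally show ?thesis .
qed

lemma mpoly_eval_const: "unital_hom c \<Longrightarrow> mpoly_eval c \<sigma> (mpoly_const a) = c a"
  unfolding mpoly_const_def
  by (simp add: mpoly_eval_single unital_hom_zero) (simp add: monom_val_def)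

lemma mpoly_eval_var: "unital_hom c \<Longrightarrow> mpoly_eval c \<sigma> (mpoly_var v) = \<sigma> v"
  unfolding mpoly_var_def
  by (simp add: mpoly_eval_single unital_hom_zero)
    (simp add: monom_val_def unital_hom_def)

lemma mpoly_eval_one: "unital_hom c \<Longrightarrow> mpoly_eval c \<sigma> 1 = 1"
  using mpoly_eval_const[of c \<sigma> 1] by (simp add: mpoly_const_def unital_hom_def)

lemma unital_hom_mpoly_eval: "unital_hom c \<Longrightarrow> unital_hom (mpoly_eval c \<sigma>)"
  unfolding unital_hom_def[of "mpoly_eval c \<sigma>"]
  by (simp add: mpoly_eval_one mpoly_eval_add mpoly_eval_mult)


section \<open>Ideals of a commutative ring\<close>

lemma module_times: "module ((*) :: 'a::comm_ring_1 \<Rightarrow> 'a \<Rightarrow> 'a)"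
  by standard (auto simp: algebra_simps)

abbreviation ring_ideal :: "'a::comm_ring_1 set \<Rightarrow> bool" where
  "ring_ideal \<equiv> module.subspace (*)"

abbreviation ideal_gen :: "'a::comm_ring_1 set \<Rightarrow> 'a set" where
  "ideal_gen \<equiv> module.span (*)"

lemmas ring_ideal_def = module.subspace_def[OF module_times]
lemmas ideal_gen_base = module.span_base[OF module_times]
lemmas ideal_gen_add = module.span_add[OF module_times]
lemmas ideal_gen_diff = module.span_diff[OF module_times]
lemmas ideal_gen_neg = module.span_neg[OF module_times]
lemmas ideal_gen_mult = module.span_scale[OF module_times]
lemmas ideal_gen_zero = module.span_zero[OF module_times]
lemmas ideal_gen_minimal = module.span_minimal[OF module_times]

lemma ring_ideal_hom_kernel:
  assumes "unital_hom h"
  shows "ring_ideal {x. h x = 0}"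
  using assms unital_hom_zero[OF assms] by (auto simp: ring_ideal_def unital_hom_def)


section \<open>The divided power algebra\<close>

text \<open>
  Basis vectors are indexed from 0.  The polynomial variable \<open>(i, s)\<close> stands for the generator
  \<open>x\<^sub>i\<^bsup>[s + 1]\<^esup>\<close>, so that exactly the divided powers of positive order are generators.
\<close>

definition dp_var :: "nat \<Rightarrow> nat \<Rightarrow> (nat \<times> nat, 'k::field) mpoly" where
  "dp_var i t = (case t of 0 \<Rightarrow> 1 | Suc s \<Rightarrow> mpoly_var (i, s))"

definition dp_relations :: "(nat \<times> nat, 'k::field) mpoly set" where
  "dp_relations =
     {dp_var i t * dp_var i s - of_nat ((t + s) choose s) * dp_var i (t + s) | i t s.
        1 \<le> t \<and> 1 \<le> s}"

quotient_type (overloaded) 'k divpow =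
  "(nat \<times> nat, 'k::field) mpoly" / "\<lambda>f g. f - g \<in> ideal_gen dp_relations"
proof (rule equivpI)
  show "reflp (\<lambda>f g :: (nat \<times> nat, 'k) mpoly. f - g \<in> ideal_gen dp_relations)"
    by (rule reflpI) (simp add: ideal_gen_zero)
  show "symp (\<lambda>f g :: (nat \<times> nat, 'k) mpoly. f - g \<in> ideal_gen dp_relations)"
    by (rule sympI) (metis ideal_gen_neg minus_diff_eq)
  show "transp (\<lambda>f g :: (nat \<times> nat, 'k) mpoly. f - g \<in> ideal_gen dp_relations)"
  proof (rule transpI)
    fix f g h :: "(nat \<times> nat, 'k) mpoly"
    assume "f - g \<in> ideal_gen dp_relations" "g - h \<in> ideal_gen dp_relations"
    from ideal_gen_add[OF this] show "f - h \<in> ideal_gen dp_relations" by simp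
  qed
qed

lemma dp_relations_zero_eval:
  fixes f :: "(nat \<times> nat, 'k::field) mpoly"
  assumes c: "unital_hom (c :: 'k \<Rightarrow> 'b::comm_ring_1)"
    and rel: "\<And>i t s. 1 \<le> t \<Longrightarrow> 1 \<le> s \<Longrightarrow>
      \<sigma> (i, t - 1) * \<sigma> (i, s - 1) = of_nat ((t + s) choose s) * \<sigma> (i, t + s - 1)"
    and f: "f \<in> ideal_gen dp_relations"
  shows "mpoly_eval c \<sigma> f = 0"
proof -
  note h = unital_hom_mpoly_eval[OF c, of \<sigma>]
  have v: "mpoly_eval c \<sigma> (dp_var i t) = \<sigma> (i, t - 1)" if "1 \<le> t" for i t
    using that by (cases t) (auto simp: dp_var_def mpoly_eval_var[OF c])
  have "dp_relations \<subseteq> {x. mpoly_eval c \<sigma> x = 0}"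
  proof
    fix x :: "(nat \<times> nat, 'k) mpoly" assume "x \<in> dp_relations"
    then obtain i t s where ts: "1 \<le> t" "1 \<le> s"
      and x: "x = dp_var i t * dp_var i s - of_nat ((t + s) choose s) * dp_var i (t + s)"
      unfolding dp_relations_def by blast
    have "mpoly_eval c \<sigma> x = 0"
      unfolding x unital_hom_diff[OF h] mpoly_eval_mult[OF c] unital_hom_of_nat[OF h]
      using ts v rel[OF ts] by simp
    then show "x \<in> {x. mpoly_eval c \<sigma> x = 0}" by simp
  qed
  from ideal_gen_minimal[OF this ring_ideal_hom_kernel[OF h]] f show ?thesis by blast
qed

instantiation divpow :: (field) comm_ring_1
begin

lift_definition zero_divpow :: "'a divpow" is 0 .
lift_definition one_divpow :: "'a divpow" is 1 .
lift_definition plus_divpow :: "'a divpow \<Rightarrow> 'a divpow \<Rightarrow> 'a divpow" is "(+)"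
  by (metis add_diff_add ideal_gen_add)
lift_definition uminus_divpow :: "'a divpow \<Rightarrow> 'a divpow" is uminus
  by (metis ideal_gen_neg minus_diff_minus)
lift_definition minus_divpow :: "'a divpow \<Rightarrow> 'a divpow \<Rightarrow> 'a divpow" is "(-)"
proof -
  fix a b c d :: "(nat \<times> nat, 'a) mpoly"
  assume "a - b \<in> ideal_gen dp_relations" "c - d \<in> ideal_gen dp_relations"
  from ideal_gen_diff[OF this] show "(a - c) - (b - d) \<in> ideal_gen dp_relations"
    by (simp add: algebra_simps)
qed
lift_definition times_divpow :: "'a divpow \<Rightarrow> 'a divpow \<Rightarrow> 'a divpow" is "(*)"
proof -
  fix a b c d :: "(nat \<times> nat, 'a) mpoly"
  assume "a - b \<in> ideal_gen dp_relations" "c - d \<in> ideal_gen dp_relations"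
  then have "c * (a - b) + b * (c - d) \<in> ideal_gen dp_relations"
    by (intro ideal_gen_add ideal_gen_mult)
  then show "a * c - b * d \<in> ideal_gen dp_relations"
    by (simp add: algebra_simps)
qed

instance
proof
  show "(0 :: 'a divpow) \<noteq> 1"
  proof
    assume "(0 :: 'a divpow) = 1"
    then have "(0 - 1 :: (nat \<times> nat, 'a) mpoly) \<in> ideal_gen dp_relations"
      by transfer
    moreover have id: "unital_hom (\<lambda>x :: 'a. x)" by (simp add: unital_hom_def)
    ultimately have "mpoly_eval (\<lambda>x :: 'a. x) (\<lambda>_. 0) (0 - 1 :: (nat \<times> nat, 'a) mpoly) = 0"
      by (intro dp_relations_zero_eval) auto
    then show False
      using unital_hom_mpoly_eval[OF id, of "\<lambda>_ :: nat \<times> nat. 0 :: 'a"]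
      by (simp add: unital_hom_uminus) (simp add: unital_hom_def)
  qed
qed (transfer; simp add: algebra_simps ideal_gen_zero)+

end

definition dp_const :: "'k::field \<Rightarrow> 'k divpow" where
  "dp_const c = abs_divpow (mpoly_const c)"

definition dp_gen :: "nat \<Rightarrow> nat \<Rightarrow> 'k::field divpow" where
  "dp_gen i t = abs_divpow (dp_var i t)"

definition dp_scale :: "'k::field \<Rightarrow> 'k divpow \<Rightarrow> 'k divpow" where
  "dp_scale c f = dp_const c * f"

lemma unital_hom_abs_divpow: "unital_hom (abs_divpow :: _ \<Rightarrow> 'k::field divpow)"
  unfolding unital_hom_def
  by (simp add: one_divpow.abs_eq plus_divpow.abs_eq times_divpow.abs_eq)

lemma unital_hom_dp_const: "unital_hom (dp_const :: 'k::field \<Rightarrow> _)"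
proof -
  have "mpoly_const (x * y) = mpoly_const x * (mpoly_const y :: (nat \<times> nat, 'k) mpoly)" for x y :: 'k
    by (simp add: mpoly_const_def mult_single)
  then show ?thesis
    using unital_hom_abs_divpow[where 'k = 'k]
    by (simp add: unital_hom_def dp_const_def) (simp add: mpoly_const_def single_add)
qed

lemma module_dp_scale: "module (dp_scale :: 'k::field \<Rightarrow> _)"
  using unital_hom_dp_const[where 'k = 'k]
  by unfold_locales (auto simp: dp_scale_def unital_hom_def algebra_simps)

lemma dp_gen_0: "dp_gen i 0 = 1"
  by (simp add: dp_gen_def dp_var_def one_divpow_def)

lemma dp_gen_mult:
  "(dp_gen i t * dp_gen i s :: 'k::field divpow) = of_nat ((t + s) choose s) * dp_gen i (t + s)"
proof (cases "t = 0 \<or> s = 0")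
  case True
  then show ?thesis by (auto simp: dp_gen_0)
next
  case False
  have "dp_var i t * dp_var i s - of_nat ((t + s) choose s) * dp_var i (t + s)
      \<in> ideal_gen (dp_relations :: (nat \<times> nat, 'k) mpoly set)"
  proof (rule ideal_gen_base)
    have "1 \<le> t" "1 \<le> s" using False by auto
    then show "dp_var i t * dp_var i s - of_nat ((t + s) choose s) * dp_var i (t + s)
        \<in> (dp_relations :: (nat \<times> nat, 'k) mpoly set)"
      unfolding dp_relations_def by blast
  qed
  then have "abs_divpow (dp_var i t * dp_var i s :: (nat \<times> nat, 'k) mpoly)
      = abs_divpow (of_nat ((t + s) choose s) * dp_var i (t + s))"
    by (simp add: divpow.abs_eq_iff)
  then show ?thesis
    using unital_hom_abs_divpow[where 'k = 'k] unital_hom_of_nat[OF unital_hom_abs_divpow[where 'k = 'k]]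
    unfolding dp_gen_def unital_hom_def by metis
qed

text \<open>
  The relations are homogeneous when the variable \<open>(i, s)\<close> has weight \<open>s + 1\<close>, so the graded pieces
  of the quotient are the images of the graded pieces of the polynomial ring.
\<close>

definition dp_weight :: "(nat \<times> nat \<Rightarrow>\<^sub>0 nat) \<Rightarrow> nat" where
  "dp_weight m = (\<Sum>(i, s)\<in>Poly_Mapping.keys m. Poly_Mapping.lookup m (i, s) * (s + 1))"

definition dp_degree_part :: "nat \<Rightarrow> 'k::field divpow set" where
  "dp_degree_part d = abs_divpow ` {f. \<forall>m\<in>Poly_Mapping.keys f. dp_weight m = d}"


section \<open>The action of the general linear group\<close>

type_synonym 'k vec = "nat \<Rightarrow>\<^sub>0 'k"

definition vec_scale :: "'k::field \<Rightarrow> 'k vec \<Rightarrow> 'k vec" where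
  "vec_scale c = Poly_Mapping.map ((*) c)"

lemma vector_space_vec_scale: "vector_space (vec_scale :: 'k::field \<Rightarrow> _)"
proof -
  have l: "Poly_Mapping.lookup (vec_scale c v) i = c * Poly_Mapping.lookup v i"
    for c :: 'k and v i
    by (simp add: vec_scale_def map.rep_eq when_def)
  show ?thesis
    by unfold_locales (auto intro!: poly_mapping_eqI simp: l lookup_add algebra_simps)
qed

definition vec_basis :: "nat \<Rightarrow> 'k::field vec" where
  "vec_basis i = Poly_Mapping.single i 1"

definition GL :: "('k::field vec \<Rightarrow> 'k vec) set" where
  "GL = {g. Vector_Spaces.linear vec_scale vec_scale g \<and> bij g \<and>
            finite {i. g (vec_basis i) \<noteq> vec_basis i}}"

text \<open>
  \<open>dp_power v t\<close> is \<open>v\<^bsup>[t]\<^esup>\<close>.  Families of exponents that are nonzero somewhere outside the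
  support of \<open>v\<close> would contribute zero and are left out to make the sum finite.
\<close>

definition exponents :: "nat set \<Rightarrow> nat \<Rightarrow> (nat \<Rightarrow> nat) set" where
  "exponents S t = {a. (\<forall>j. j \<notin> S \<longrightarrow> a j = 0) \<and> (\<Sum>j\<in>S. a j) = t}"

definition dp_power :: "'k::field vec \<Rightarrow> nat \<Rightarrow> 'k divpow" where
  "dp_power v t =
     (\<Sum>a\<in>exponents (Poly_Mapping.keys v) t. \<Prod>j\<in>Poly_Mapping.keys v.
        dp_scale (Poly_Mapping.lookup v j ^ a j) (dp_gen j (a j)))"

lemma exponents_insert:
  assumes "finite S" "x \<notin> S"
  shows "bij_betw (\<lambda>(u, a). a(x := u)) (SIGMA u:{..t}. exponents S (t - u)) (exponents (insert x S) t)"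
proof (rule bij_betwI[where g = "\<lambda>a. (a x, a(x := 0))"])
  have eq: "(\<Sum>j\<in>S. if j = x then u else a j) = sum a S" for a :: "nat \<Rightarrow> nat" and u
    using assms by (intro sum.cong) auto
  show "(\<lambda>(u, a). a(x := u)) \<in> (SIGMA u:{..t}. exponents S (t - u)) \<rightarrow> exponents (insert x S) t"
    using assms by (auto simp: exponents_def eq)
  show "(\<lambda>a. (a x, a(x := 0))) \<in> exponents (insert x S) t \<rightarrow> (SIGMA u:{..t}. exponents S (t - u))"
    using assms by (auto simp: exponents_def eq)
  show "(case (a x, a(x := 0)) of (u, a) \<Rightarrow> a(x := u)) = a" for a :: "nat \<Rightarrow> nat"
    by simp
  show "(\<lambda>a. (a x, a(x := 0))) (case ua of (u, a) \<Rightarrow> a(x := u)) = ua"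
    if "ua \<in> (SIGMA u:{..t}. exponents S (t - u))" for ua
    using that assms by (auto simp: exponents_def fun_eq_iff)
qed

lemma finite_exponents: "finite S \<Longrightarrow> finite (exponents S t)"
proof (induction S arbitrary: t rule: finite_induct)
  case empty
  have "exponents {} t \<subseteq> {\<lambda>_. 0}" by (auto simp: exponents_def)
  then show ?case by (rule finite_subset) simp
next
  case (insert x S)
  have "finite (SIGMA u:{..t}. exponents S (t - u))"
    using insert.IH by (intro finite_SigmaI) auto
  then show ?case
    using exponents_insert[OF insert.hyps] bij_betw_finite by blast
qed

lemma divided_power_convolution:
  fixes a b :: "nat \<Rightarrow> 'a::comm_ring_1"
  assumes a: "\<And>t s. a t * a s = of_nat ((t + s) choose s) * a (t + s)"
    and b: "\<And>t s. b t * b s = of_nat ((t + s) choose s) * b (t + s)"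
  defines "c \<equiv> \<lambda>t. \<Sum>u\<le>t. a u * b (t - u)"
  shows "c t * c s = of_nat ((t + s) choose s) * c (t + s)"
proof -
  have "c t * c s = (\<Sum>(w, u)\<in>{..s} \<times> {..t}. (a u * b (t - u)) * (a w * b (s - w)))"
    unfolding c_def by (subst mult.commute) (simp add: sum_product sum.cartesian_product mult_ac)
  also have "\<dots> = (\<Sum>(w, u)\<in>{..s} \<times> {..t}.
      of_nat (((u + w) choose w) * ((t + s - (u + w)) choose (s - w))) * (a (u + w) * b (t + s - (u + w))))"
  proof (intro sum.cong refl, unfold split_paired_all prod.case)
    fix w u assume "(w, u) \<in> {..s} \<times> {..t}"
    then have e: "(t - u) + (s - w) = t + s - (u + w)" by simp
    have "(a u * b (t - u)) * (a w * b (s - w)) = (a u * a w) * (b (t - u) * b (s - w))"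
      by (simp add: mult_ac)
    then show "(a u * b (t - u)) * (a w * b (s - w)) =
      of_nat (((u + w) choose w) * ((t + s - (u + w)) choose (s - w))) * (a (u + w) * b (t + s - (u + w)))"
      unfolding a b e by (simp add: mult_ac)
  qed
  also have "\<dots> = (\<Sum>(m, w)\<in>(SIGMA m:{..t + s}. {w. w \<le> s \<and> w \<le> m \<and> m - w \<le> t}).
      of_nat ((m choose w) * ((t + s - m) choose (s - w))) * (a m * b (t + s - m)))"
    by (rule sum.reindex_bij_witness[where i = "\<lambda>(m, w). (w, m - w)" and j = "\<lambda>(w, u). (u + w, w)"])
      auto
  also have "\<dots> = (\<Sum>m\<le>t + s. \<Sum>w\<in>{w. w \<le> s \<and> w \<le> m \<and> m - w \<le> t}.
      of_nat ((m choose w) * ((t + s - m) choose (s - w))) * (a m * b (t + s - m)))"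
    by (subst sum.Sigma) auto
  also have "\<dots> = (\<Sum>m\<le>t + s. of_nat ((t + s) choose s) * (a m * b (t + s - m)))"
  proof (intro sum.cong refl)
    fix m assume m: "m \<in> {..t + s}"
    have "(\<Sum>w\<in>{w. w \<le> s \<and> w \<le> m \<and> m - w \<le> t}. (m choose w) * ((t + s - m) choose (s - w)))
        = (\<Sum>w\<le>s. (m choose w) * ((t + s - m) choose (s - w)))"
      using m by (intro sum.mono_neutral_left) (auto simp: not_le)
    also have "\<dots> = (t + s) choose s"
      using m vandermonde[of m "t + s - m" s] by simp
    finally show "(\<Sum>w\<in>{w. w \<le> s \<and> w \<le> m \<and> m - w \<le> t}.
        of_nat ((m choose w) * ((t + s - m) choose (s - w))) * (a m * b (t + s - m)))
      = of_nat ((t + s) choose s) * (a m * b (t + s - m))"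
      unfolding sum_distrib_right[symmetric] of_nat_sum[symmetric] by simp
  qed
  finally show ?thesis unfolding c_def by (simp add: sum_distrib_left)
qed

lemma dp_power_mult:
  fixes v :: "'k::field vec"
  shows "dp_power v t * dp_power v s = of_nat ((t + s) choose s) * dp_power v (t + s)"
proof -
  define C where "C = (\<lambda>S t. \<Sum>a\<in>exponents S t. \<Prod>j\<in>S.
    dp_scale (Poly_Mapping.lookup v j ^ a j) (dp_gen j (a j)))"
  have "C S t * C S s = of_nat ((t + s) choose s) * C S (t + s)" if "finite S" for S t s
    using that
  proof (induction S arbitrary: t s rule: finite_induct)
    case empty
    have "exponents {} t = (if t = 0 then {\<lambda>_. 0} else {})" for t
      by (auto simp: exponents_def)
    then show ?case by (simp add: C_def)
  next
    case (insert x S)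
    define A where "A = (\<lambda>u. dp_scale (Poly_Mapping.lookup v x ^ u) (dp_gen x u))"
    have A: "A t * A s = of_nat ((t + s) choose s) * A (t + s)" for t s
    proof -
      have "A t * A s = dp_const (Poly_Mapping.lookup v x ^ (t + s)) * (dp_gen x t * dp_gen x s)"
        using unital_hom_dp_const[where 'k = 'k]
        unfolding A_def dp_scale_def power_add unital_hom_def by (simp add: mult_ac)
      then show ?thesis
        unfolding dp_gen_mult by (simp add: A_def dp_scale_def mult_ac)
    qed
    have "C (insert x S) t = (\<Sum>u\<le>t. A u * C S (t - u))" for t
    proof -
      have "C (insert x S) t = (\<Sum>(u, a)\<in>(SIGMA u:{..t}. exponents S (t - u)).
          A u * (\<Prod>j\<in>S. dp_scale (Poly_Mapping.lookup v j ^ a j) (dp_gen j (a j))))"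
        unfolding C_def
      proof (subst sum.reindex_bij_betw[OF exponents_insert[OF insert.hyps], symmetric],
          intro sum.cong refl, unfold split_paired_all prod.case)
        fix u a
        have "(\<Prod>j\<in>S. dp_scale (Poly_Mapping.lookup v j ^ (a(x := u)) j) (dp_gen j ((a(x := u)) j)))
            = (\<Prod>j\<in>S. dp_scale (Poly_Mapping.lookup v j ^ a j) (dp_gen j (a j)))"
          using insert.hyps by (intro prod.cong) auto
        then show "(\<Prod>j\<in>insert x S. dp_scale (Poly_Mapping.lookup v j ^ (a(x := u)) j)
              (dp_gen j ((a(x := u)) j)))
            = A u * (\<Prod>j\<in>S. dp_scale (Poly_Mapping.lookup v j ^ a j) (dp_gen j (a j)))"
          using insert.hyps by (simp add: A_def)
      qed
      also have "\<dots> = (\<Sum>u\<le>t. \<Sum>a\<in>exponents S (t - u).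
          A u * (\<Prod>j\<in>S. dp_scale (Poly_Mapping.lookup v j ^ a j) (dp_gen j (a j))))"
        using insert.hyps by (subst sum.Sigma) (auto simp: finite_exponents)
      finally show ?thesis by (simp add: C_def sum_distrib_left)
    qed
    then show ?case
      using divided_power_convolution[of A "C S" t s, OF A insert.IH] by simp
  qed
  then show ?thesis unfolding dp_power_def C_def by simp
qed

lift_definition gl_act :: "('k::field vec \<Rightarrow> 'k vec) \<Rightarrow> 'k divpow \<Rightarrow> 'k divpow" is
  "\<lambda>g. mpoly_eval dp_const (\<lambda>(i, s). dp_power (g (vec_basis i)) (s + 1))"
proof -
  fix g :: "'k vec \<Rightarrow> 'k vec" and f f' :: "(nat \<times> nat, 'k) mpoly"
  let ?e = "mpoly_eval dp_const (\<lambda>(i, s). dp_power (g (vec_basis i)) (s + 1))"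
  assume "f - f' \<in> ideal_gen dp_relations"
  then have "?e (f - f') = 0"
    by (rule dp_relations_zero_eval[OF unital_hom_dp_const, rotated]) (simp add: dp_power_mult)
  then show "?e f = ?e f'"
    by (simp add: unital_hom_diff[OF unital_hom_mpoly_eval[OF unital_hom_dp_const]])
qed

lemma unital_hom_gl_act: "unital_hom (gl_act (g :: 'k::field vec \<Rightarrow> 'k vec))"
  unfolding unital_hom_def
proof (intro conjI allI)
  have "gl_act g (abs_divpow 1) = 1"
    by (simp add: gl_act.abs_eq mpoly_eval_one[OF unital_hom_dp_const])
  then show "gl_act g 1 = 1"
    by (simp add: one_divpow.abs_eq[symmetric])
  show "gl_act g (x + y) = gl_act g x + gl_act g y" for x y
    by (induction x rule: divpow.abs_induct, induction y rule: divpow.abs_induct)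
      (simp add: plus_divpow.abs_eq gl_act.abs_eq mpoly_eval_add[OF unital_hom_dp_const])
  show "gl_act g (x * y) = gl_act g x * gl_act g y" for x y
    by (induction x rule: divpow.abs_induct, induction y rule: divpow.abs_induct)
      (simp add: times_divpow.abs_eq gl_act.abs_eq mpoly_eval_mult[OF unital_hom_dp_const])
qed

lemma gl_act_const: "gl_act g (dp_const c) = dp_const c"
  by (subst dp_const_def) (simp add: gl_act.abs_eq mpoly_eval_const[OF unital_hom_dp_const])

lemma gl_act_gen: "1 \<le> t \<Longrightarrow> gl_act g (dp_gen i t) = dp_power (g (vec_basis i)) t"
  unfolding dp_gen_def gl_act.abs_eq dp_var_def
  by (cases t) (auto simp: mpoly_eval_var[OF unital_hom_dp_const])


section \<open>The equivariant spectrum\<close>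

definition gl_ideal :: "'k::field divpow set \<Rightarrow> bool" where
  "gl_ideal I \<longleftrightarrow> ring_ideal I \<and> (\<forall>g\<in>GL. gl_act g ` I \<subseteq> I)"

definition gl_prime :: "'k::field divpow set \<Rightarrow> bool" where
  "gl_prime P \<longleftrightarrow> gl_ideal P \<and> P \<noteq> UNIV \<and>
     (\<forall>I J. gl_ideal I \<longrightarrow> gl_ideal J \<longrightarrow> ideal_gen {x * y | x y. x \<in> I \<and> y \<in> J} \<subseteq> P \<longrightarrow>
        I \<subseteq> P \<or> J \<subseteq> P)"

definition gl_spec :: "'k::field divpow set topology" where
  "gl_spec = topology (\<lambda>U. \<exists>I. gl_ideal I \<and> U = {P. gl_prime P} - {P. gl_prime P \<and> I \<subseteq> P})"

lemma gl_ideal_hull: "gl_ideal (gl_ideal hull S)"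
proof (rule hull_in)
  fix T :: "'a divpow set set" assume "Ball T gl_ideal"
  then show "gl_ideal (\<Inter>T)"
    unfolding gl_ideal_def ring_ideal_def by (auto simp: image_subset_iff)
qed

lemma gl_ideal_inter: "gl_ideal I \<Longrightarrow> gl_ideal J \<Longrightarrow> gl_ideal (I \<inter> J)"
  unfolding gl_ideal_def ring_ideal_def by (auto simp: image_subset_iff)

lemma gl_ideal_mult_subset:
  assumes "gl_ideal I" "gl_ideal J"
  shows "ideal_gen {x * y | x y. x \<in> I \<and> y \<in> J} \<subseteq> I \<inter> J"
proof (rule ideal_gen_minimal)
  show "{x * y | x y. x \<in> I \<and> y \<in> J} \<subseteq> I \<inter> J"
    using assms unfolding gl_ideal_def ring_ideal_def by (auto, metis mult.commute)
  show "ring_ideal (I \<inter> J)"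
    using gl_ideal_inter[OF assms] by (simp add: gl_ideal_def)
qed

lemma istopology_gl_spec:
  "istopology (\<lambda>U. \<exists>I. gl_ideal I \<and> U = {P. gl_prime P} - {P. gl_prime P \<and> I \<subseteq> P})"
  unfolding istopology_def
proof (intro conjI allI impI; (elim exE conjE)?)
  fix S T :: "'a divpow set set" and I J :: "'a divpow set"
  assume I: "gl_ideal I" and S: "S = {P. gl_prime P} - {P. gl_prime P \<and> I \<subseteq> P}"
    and J: "gl_ideal J" and T: "T = {P. gl_prime P} - {P. gl_prime P \<and> J \<subseteq> P}"
  have "I \<subseteq> P \<or> J \<subseteq> P" if "gl_prime P" "I \<inter> J \<subseteq> P" for P
    using that gl_ideal_mult_subset[OF I J] I J unfolding gl_prime_def
    by (meson subset_trans)
  then have "S \<inter> T = {P. gl_prime P} - {P. gl_prime P \<and> I \<inter> J \<subseteq> P}"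
    unfolding S T by blast
  then show "\<exists>I. gl_ideal I \<and> S \<inter> T = {P. gl_prime P} - {P. gl_prime P \<and> I \<subseteq> P}"
    using gl_ideal_inter[OF I J] by blast
next
  fix K :: "'a divpow set set set"
  assume "\<forall>U\<in>K. \<exists>I. gl_ideal I \<and> U = {P. gl_prime P} - {P. gl_prime P \<and> I \<subseteq> P}"
  then obtain F where F: "\<And>U. U \<in> K \<Longrightarrow> gl_ideal (F U)"
      "\<And>U. U \<in> K \<Longrightarrow> U = {P. gl_prime P} - {P. gl_prime P \<and> F U \<subseteq> P}"
    by metis
  let ?H = "gl_ideal hull (\<Union>(F ` K))"
  have H: "?H \<subseteq> P \<longleftrightarrow> (\<forall>U\<in>K. F U \<subseteq> P)" if "gl_prime P" for P
    using that hull_subset[of "\<Union>(F ` K)" gl_ideal] hull_minimal[of "\<Union>(F ` K)" P gl_ideal]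
    unfolding gl_prime_def by blast
  have "P \<in> U \<longleftrightarrow> gl_prime P \<and> \<not> F U \<subseteq> P" if "U \<in> K" for P U
    by (subst F(2)[OF that]) auto
  then have "\<Union>K = {P. gl_prime P} - {P. gl_prime P \<and> ?H \<subseteq> P}"
    by (intro set_eqI) (use H in auto)
  then show "\<exists>I. gl_ideal I \<and> \<Union>K = {P. gl_prime P} - {P. gl_prime P \<and> I \<subseteq> P}"
    using gl_ideal_hull by blast
qed

lemma closedin_gl_spec:
  "closedin gl_spec C \<longleftrightarrow> (\<exists>I. gl_ideal I \<and> C = {P. gl_prime P \<and> I \<subseteq> P})"
proof -
  have o: "openin gl_spec U \<longleftrightarrow>
      (\<exists>I. gl_ideal I \<and> U = {P. gl_prime P} - {P. gl_prime P \<and> I \<subseteq> P})" for U :: "'a divpow set set"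
    by (simp add: gl_spec_def topology_inverse'[OF istopology_gl_spec])
  have "gl_ideal (UNIV :: 'a divpow set)" by (simp add: gl_ideal_def ring_ideal_def)
  moreover have "P \<noteq> UNIV" if "gl_prime P" for P :: "'a divpow set"
    using that by (simp add: gl_prime_def)
  ultimately have "openin gl_spec {P :: 'a divpow set. gl_prime P}"
    unfolding o by (intro exI[of _ UNIV]) auto
  then have t: "topspace gl_spec = {P :: 'a divpow set. gl_prime P}"
    unfolding topspace_def using o by blast
  show ?thesis
    unfolding closedin_def t o by blast
qed


section \<open>The right-order topology on the extended naturals\<close>

definition right_order :: "enat topology" where
  "right_order = topology (\<lambda>U. U = UNIV \<or> (\<exists>n. U = - {n..}))"

lemma istopology_right_order: "istopology (\<lambda>U :: enat set. U = UNIV \<or> (\<exists>n. U = - {n..}))"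
  unfolding istopology_def
proof (intro conjI allI impI)
  fix S T :: "enat set"
  assume "S = UNIV \<or> (\<exists>n. S = - {n..})" "T = UNIV \<or> (\<exists>n. T = - {n..})"
  moreover have "- {m..} \<inter> - {n..} = - {min m n..}" for m n :: enat
    by (auto simp: min_def)
  ultimately show "S \<inter> T = UNIV \<or> (\<exists>n. S \<inter> T = - {n..})"
    by (metis inf_top_left inf_top_right)
next
  fix K :: "enat set set"
  assume K: "\<forall>U\<in>K. U = UNIV \<or> (\<exists>n. U = - {n..})"
  show "\<Union>K = UNIV \<or> (\<exists>n. \<Union>K = - {n..})"
  proof (cases "UNIV \<in> K")
    case True
    then show ?thesis by blast
  next
    case False
    define N where "N = {n. - {n..} \<in> K}"
    have "K = (\<lambda>n. - {n..}) ` N"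
    proof (intro equalityI subsetI)
      fix U assume U: "U \<in> K"
      then obtain n where "U = - {n..}" using K False by metis
      then show "U \<in> (\<lambda>n. - {n..}) ` N" using U by (simp add: N_def)
    qed (auto simp: N_def)
    then have "\<Union>K = (\<Union>n\<in>N. - {n..})"
      by simp
    also have "\<dots> = - {Sup N..}"
      by (auto simp: not_le less_Sup_iff)
    finally show ?thesis by blast
  qed
qed

lemma closedin_right_order: "closedin right_order C \<longleftrightarrow> C = {} \<or> (\<exists>n. C = {n..})"
proof -
  have o: "openin right_order U \<longleftrightarrow> U = UNIV \<or> (\<exists>n. U = - {n..})" for U
    unfolding right_order_def topology_inverse'[OF istopology_right_order] ..
  have "openin right_order UNIV" unfolding o by simp
  then have "topspace right_order = UNIV" using openin_subset by blast
  then show ?thesis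
    unfolding closedin_def o Compl_eq_Diff_UNIV[symmetric] by (auto simp del: Compl_atLeast)
qed


section \<open>The ideals\<close>

text \<open>
  At \<open>\<infinity>\<close> this is the homogeneous maximal ideal, that is, the direct sum of the graded pieces of
  positive degree; the argument \<open>p\<close> is meant to be the characteristic of the field.
\<close>

definition dp_ideal :: "nat \<Rightarrow> enat \<Rightarrow> 'k::field divpow set" where
  "dp_ideal p n =
     (case n of
        enat r \<Rightarrow> if r = 0 then {0} else gl_ideal hull (\<Union>d\<in>{1..p ^ (r - 1)}. dp_degree_part d)
      | \<infinity> \<Rightarrow> module.span dp_scale (\<Union>d\<in>{1..}. dp_degree_part d))"

end

theory Submission
  imports Defs "HOL-Computational_Algebra.Formal_Power_Series"
begin

text \<open>
  The divided monomials form a basis of weight vectors with distinct weights, so over an infinite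
  field every equivariant ideal is spanned by monomials.  Since \<open>x\<^bsup>[p\<^sup>s m]\<^esup>\<close> is a unit times
  \<open>x\<^bsup>[p\<^sup>s]\<^esup> x\<^bsup>[p\<^sup>s m - p\<^sup>s]\<^esup>\<close> when \<open>p\<close> does not divide \<open>m\<close>, the ideal \<open>I\<^sub>r\<close> is spanned by the monomials with
  some exponent not divisible by \<open>p\<^sup>r\<close>.  The remaining exponents are closed under addition, and
  transvections move a monomial to variables disjoint from those of another one, where multiplying
  monomials produces no binomial coefficient; this makes \<open>I\<^sub>r\<close> prime.  Conversely, a prime that
  contains \<open>I\<^sub>r\<close> and a monomial outside \<open>I\<^sub>r\<close> contains \<open>I\<^bsub>r+1\<^esub>\<close>, by splitting off one factor
  \<open>x\<^sub>n\<^bsup>[p\<^sup>r]\<^esup>\<close> at a time.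
\<close>

section \<open>The monomial basis\<close>

text \<open>Two obstacles shape the proof. \<open>D\<close> is a bare quotient of a polynomial ring,
  so linear independence of the divided monomials must be proved, and in characteristic
  \<open>p\<close> factorials cannot be inverted in \<open>k\<close>. The coordinates are therefore
  copied from the model over the rationals, where \<open>x_i^[t] = x_i^t / t!\<close>: they are
  ratios of factorials, computed exactly in the natural numbers and only then mapped to
  \<open>k\<close>. Moreover \<open>gl_act\<close> is known only on generators, so compatibility
  with composition has to be derived before inverses can be used, as primality of a given ideal
  requires. Stability of the monomial ideals, in contrast, needs no formula for the action, only
  degrees: a nonzero exponent divisible by \<open>p^r\<close> has degree at least
  \<open>p^r\<close>, so everything of positive degree below \<open>p^r\<close> lies in
  \<open>I_r\<close>, while \<open>p^(r-1)\<close> is the degree of the last generators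
  \<open>x_i^[p^s]\<close>, \<open>s < r\<close>. This explains the bound in the definition of
  \<open>I_r\<close>. All the ideals, the one at infinity included, belong to one family indexed by
  \<open>enat\<close> and ordered by inclusion as their indices; the topology then follows from the
  well-order of \<open>enat\<close>.\<close>

definition exp_fact :: "(nat \<Rightarrow>\<^sub>0 nat) \<Rightarrow> nat" where
  "exp_fact a = (\<Prod>i\<in>Poly_Mapping.keys a. fact (Poly_Mapping.lookup a i))"

text \<open>The structure constant for multiplying divided monomials, see
  \<open>dp_monom_mult\<close>.\<close>

definition exp_binom :: "(nat \<Rightarrow>\<^sub>0 nat) \<Rightarrow> (nat \<Rightarrow>\<^sub>0 nat) \<Rightarrow> nat" where
  "exp_binom a b = (\<Prod>i\<in>Poly_Mapping.keys a \<union> Poly_Mapping.keys b.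
     (Poly_Mapping.lookup a i + Poly_Mapping.lookup b i) choose Poly_Mapping.lookup a i)"

lemma exp_fact_superset:
  "finite S \<Longrightarrow> Poly_Mapping.keys a \<subseteq> S \<Longrightarrow> exp_fact a = (\<Prod>i\<in>S. fact (Poly_Mapping.lookup a i))"
  unfolding exp_fact_def by (intro prod.mono_neutral_left) (auto simp: in_keys_iff)

lemma exp_fact_add: "exp_fact (a + b) = exp_binom a b * exp_fact a * exp_fact b"
proof -
  let ?S = "Poly_Mapping.keys a \<union> Poly_Mapping.keys b"
  have f: "fact (x + y) = ((x + y) choose x) * fact x * (fact y :: nat)" for x y
    using binomial_fact_lemma[of x "x + y"] by (simp add: mult_ac)
  have "exp_fact (a + b) = (\<Prod>i\<in>?S. fact (Poly_Mapping.lookup (a + b) i))"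
    by (rule exp_fact_superset) (auto simp: Poly_Mapping.keys_add)
  also have "\<dots> = exp_binom a b * (\<Prod>i\<in>?S. fact (Poly_Mapping.lookup a i))
      * (\<Prod>i\<in>?S. fact (Poly_Mapping.lookup b i))"
    by (simp add: lookup_add f exp_binom_def prod.distrib)
  also have "\<dots> = exp_binom a b * exp_fact a * exp_fact b"
    using exp_fact_superset[of ?S a] exp_fact_superset[of ?S b] by simp
  finally show ?thesis .
qed

lemma exp_fact_single: "exp_fact (Poly_Mapping.single i t) = fact t"
  by (subst exp_fact_superset[where S = "{i}"]) auto

section \<open>Monomials in the generators as integer multiples of divided monomials\<close>

definition var_exp :: "(nat \<times> nat \<Rightarrow>\<^sub>0 nat) \<Rightarrow> (nat \<Rightarrow>\<^sub>0 nat)" where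
  "var_exp m = (\<Sum>v\<in>Poly_Mapping.keys m.
     Poly_Mapping.single (fst v) (Poly_Mapping.lookup m v * (snd v + 1)))"

text \<open>In characteristic zero \<open>x_i^[t]\<close> is \<open>x_i^t / t!\<close>, so this is
  the denominator of \<open>m\<close> written in ordinary powers; the ordinary monomial is in turn
  \<open>exp_fact (var_exp m)\<close> times the divided one.\<close>

definition var_fact :: "(nat \<times> nat \<Rightarrow>\<^sub>0 nat) \<Rightarrow> nat" where
  "var_fact m = (\<Prod>v\<in>Poly_Mapping.keys m. fact (snd v + 1) ^ Poly_Mapping.lookup m v)"

lemma var_exp_add: "var_exp (m + n) = var_exp m + var_exp n"
  unfolding var_exp_def
  by (rule setsum_keys_plus_distrib) (simp_all add: single_add[symmetric] algebra_simps)

lemma var_exp_single: "var_exp (Poly_Mapping.single (i, s) e) = Poly_Mapping.single i (e * (s + 1))"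
  by (simp add: var_exp_def)

lemma var_fact_superset:
  "finite S \<Longrightarrow> Poly_Mapping.keys m \<subseteq> S \<Longrightarrow>
    var_fact m = (\<Prod>v\<in>S. fact (snd v + 1) ^ Poly_Mapping.lookup m v)"
  unfolding var_fact_def by (intro prod.mono_neutral_left) (auto simp: in_keys_iff)

lemma var_fact_add: "var_fact (m + n) = var_fact m * var_fact n"
proof -
  let ?S = "Poly_Mapping.keys m \<union> Poly_Mapping.keys n"
  have "Poly_Mapping.keys (m + n) \<subseteq> ?S" by (rule Poly_Mapping.keys_add)
  then show ?thesis
    using var_fact_superset[of ?S "m + n"] var_fact_superset[of ?S m] var_fact_superset[of ?S n]
    by (simp add: lookup_add power_add prod.distrib)
qed

lemma var_fact_single: "var_fact (Poly_Mapping.single (i, s) e) = fact (s + 1) ^ e"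
  by (subst var_fact_superset[where S = "{(i, s)}"]) auto

lemma var_fact_pos: "var_fact m > 0"
  unfolding var_fact_def by (auto intro!: prod_pos)

text \<open>The quotient is a product of multinomial coefficients. One more copy of a generator
  multiplies \<open>var_fact\<close> by a factorial, and \<open>exp_fact\<close> by the same
  factorial times the natural number \<open>exp_binom\<close>.\<close>

lemma var_fact_dvd: "var_fact m dvd exp_fact (var_exp m)"
proof (induction m rule: update_induct)
  case const
  show ?case by (simp add: var_fact_def)
next
  case (update f v b)
  obtain i s where v: "v = (i, s)" by (cases v)
  have "var_fact (f + Poly_Mapping.single (i, s) e) dvd
      exp_fact (var_exp (f + Poly_Mapping.single (i, s) e))" for e
  proof (induction e)
    case 0
    show ?case using update.IH by simp
  next
    case (Suc e)
    have "f + Poly_Mapping.single (i, s) (Suc e)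
        = (f + Poly_Mapping.single (i, s) e) + Poly_Mapping.single (i, s) 1"
      by (simp add: single_add[symmetric] add.assoc)
    moreover have "var_fact (g + Poly_Mapping.single (i, s) 1) dvd
        exp_fact (var_exp (g + Poly_Mapping.single (i, s) 1))"
      if "var_fact g dvd exp_fact (var_exp g)" for g
      unfolding var_fact_add var_exp_add exp_fact_add var_fact_single var_exp_single exp_fact_single
      using that by (intro mult_dvd_mono) auto
    ultimately show ?case using Suc by metis
  qed
  moreover have "Poly_Mapping.update v b f = f + Poly_Mapping.single v b"
    using update by (intro poly_mapping_eqI) (auto simp: lookup_update lookup_add lookup_single in_keys_iff when_def)
  ultimately show ?case using v by metis
qed

text \<open>A monomial \<open>m\<close> in the generators equals \<open>var_coef m\<close> times the divided monomial with exponent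
  \<open>var_exp m\<close> in \<open>D\<close>; the quotient is exact by \<open>var_fact_dvd\<close>.\<close>

definition var_coef :: "(nat \<times> nat \<Rightarrow>\<^sub>0 nat) \<Rightarrow> nat" where
  "var_coef m = exp_fact (var_exp m) div var_fact m"

lemma var_coef_unique: "c * var_fact m = exp_fact (var_exp m) \<Longrightarrow> var_coef m = c"
  using var_fact_pos[of m] unfolding var_coef_def by (metis div_mult_self_is_m)

lemma var_coef_fact: "var_coef m * var_fact m = exp_fact (var_exp m)"
  using var_fact_dvd[of m] by (simp add: var_coef_def)

text \<open>The future coordinate of \<open>f\<close> at the divided monomial of exponent
  \<open>a\<close>. It is set up on polynomials, where monomials are independent by construction,
  and descends to \<open>D\<close> once it is seen to kill the relations.\<close>

definition mpoly_coef :: "(nat \<Rightarrow>\<^sub>0 nat) \<Rightarrow> (nat \<times> nat, 'k::field) mpoly \<Rightarrow> 'k" where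
  "mpoly_coef a f = (\<Sum>m\<in>Poly_Mapping.keys f.
     if var_exp m = a then of_nat (var_coef m) * Poly_Mapping.lookup f m else 0)"

lemma mpoly_coef_add: "mpoly_coef a (f + g) = mpoly_coef a f + mpoly_coef a g"
  unfolding mpoly_coef_def
  by (rule setsum_keys_plus_distrib) (simp_all add: algebra_simps)

lemma mpoly_coef_zero: "mpoly_coef a 0 = 0"
  by (simp add: mpoly_coef_def)

lemma mpoly_coef_diff: "mpoly_coef a (f - g) = mpoly_coef a f - mpoly_coef a g"
  using mpoly_coef_add[of a "f - g" g] by (simp add: algebra_simps)

lemma mpoly_coef_sum: "mpoly_coef a (sum F S) = (\<Sum>x\<in>S. mpoly_coef a (F x))"
  by (induction S rule: infinite_finite_induct) (auto simp: mpoly_coef_add mpoly_coef_zero)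

lemma mpoly_coef_single:
  "mpoly_coef a (Poly_Mapping.single m c) = (if var_exp m = a then of_nat (var_coef m) * c else 0)"
  by (cases "c = 0") (auto simp: mpoly_coef_def)

lemma dp_var_pos: "1 \<le> t \<Longrightarrow> dp_var i t = Poly_Mapping.single (Poly_Mapping.single (i, t - 1) 1) 1"
  by (cases t) (auto simp: dp_var_def mpoly_var_def)

text \<open>Multiplied by a monomial, the two terms of a relation have the same
  \<open>var_exp\<close>, and their \<open>var_fact\<close> differ by exactly the binomial
  coefficient of the relation. The resulting identity between the \<open>var_coef\<close> holds in
  the natural numbers, hence in every characteristic.\<close>

lemma mpoly_coef_relation:
  assumes "x \<in> dp_relations"
  shows "mpoly_coef a (h * x :: (nat \<times> nat, 'k::field) mpoly) = 0"
proof -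
  obtain i t s where ts: "1 \<le> t" "1 \<le> s"
    and x: "x = dp_var i t * dp_var i s - of_nat ((t + s) choose s) * dp_var i (t + s)"
    using assms unfolding dp_relations_def by blast
  define b where "b = (t + s) choose s"
  have "mpoly_coef a (Poly_Mapping.single m c * x) = 0" for m and c :: 'k
  proof -
    define m1 where "m1 = m + (Poly_Mapping.single (i, t - 1) 1 + Poly_Mapping.single (i, s - 1) 1)"
    define m2 where "m2 = m + Poly_Mapping.single (i, t + s - 1) 1"
    have e: "var_exp m1 = var_exp m2"
      using ts by (simp add: m1_def m2_def var_exp_add var_exp_single single_add[symmetric])
    have "fact (t + s) = b * fact t * (fact s :: nat)"
      using binomial_fact_lemma[of s "t + s"] by (simp add: mult_ac b_def)
    then have f: "var_fact m2 = b * var_fact m1"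
      using ts by (simp add: m1_def m2_def var_fact_add var_fact_single)
    have "(b * var_coef m2) * var_fact m1 = exp_fact (var_exp m1)"
      using var_coef_fact[of m2] by (simp add: e f mult_ac)
    then have c: "var_coef m1 = b * var_coef m2"
      by (rule var_coef_unique)
    have bs: "(of_nat b :: (nat \<times> nat, 'k) mpoly) = Poly_Mapping.single 0 (of_nat b)"
      by (simp add: single_of_nat)
    have "Poly_Mapping.single m c * x
        = Poly_Mapping.single m1 c - Poly_Mapping.single m2 (c * of_nat b)"
      unfolding x b_def[symmetric] bs using ts
      by (simp add: dp_var_pos mult_single right_diff_distrib m1_def m2_def del: single_of_nat)
    then show ?thesis
      by (simp add: mpoly_coef_diff mpoly_coef_single e c mult_ac)
  qed
  then show ?thesis
    by (subst mpoly_sum_singles[of h]) (simp add: sum_distrib_right mpoly_coef_sum)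
qed

lemma mpoly_coef_ideal: "f \<in> ideal_gen dp_relations \<Longrightarrow> mpoly_coef a f = 0"
  by (erule module.span_induct_alt[OF module_times, where h = "\<lambda>f. mpoly_coef a f = 0"])
    (auto simp: mpoly_coef_zero mpoly_coef_add mpoly_coef_relation)

lift_definition dp_coef :: "(nat \<Rightarrow>\<^sub>0 nat) \<Rightarrow> 'k::field divpow \<Rightarrow> 'k" is mpoly_coef
  using mpoly_coef_ideal mpoly_coef_diff by (metis eq_iff_diff_eq_0)

lemma dp_coef_add: "dp_coef a (f + g) = dp_coef a f + dp_coef a g"
  by transfer (rule mpoly_coef_add)

lemma dp_coef_zero: "dp_coef a 0 = 0"
  by transfer (rule mpoly_coef_zero)

lemma dp_coef_diff: "dp_coef a (f - g) = dp_coef a f - dp_coef a g"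
  by transfer (rule mpoly_coef_diff)

lemma dp_coef_sum: "dp_coef a (sum F S) = (\<Sum>x\<in>S. dp_coef a (F x))"
  by (induction S rule: infinite_finite_induct) (auto simp: dp_coef_add dp_coef_zero)

lemma dp_coef_scale: "dp_coef a (dp_scale c f) = c * dp_coef a (f :: 'k::field divpow)"
proof (induction f rule: divpow.abs_induct)
  fix f :: "(nat \<times> nat, 'k) mpoly"
  have "mpoly_coef a (mpoly_const c * f) = c * mpoly_coef a f"
    by (subst (1 2) mpoly_sum_singles[of f])
      (auto simp: sum_distrib_left mpoly_coef_sum mpoly_const_def mult_single mpoly_coef_single
        intro!: sum.cong)
  then show "dp_coef a (dp_scale c (abs_divpow f)) = c * dp_coef a (abs_divpow f)"
    by (simp add: dp_scale_def dp_const_def times_divpow.abs_eq dp_coef.abs_eq)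
qed

section \<open>The divided monomials form a basis\<close>

definition dp_monom :: "(nat \<Rightarrow>\<^sub>0 nat) \<Rightarrow> 'k::field divpow" where
  "dp_monom a = (\<Prod>i\<in>Poly_Mapping.keys a. dp_gen i (Poly_Mapping.lookup a i))"

lemma dp_monom_superset:
  "finite S \<Longrightarrow> Poly_Mapping.keys a \<subseteq> S \<Longrightarrow>
    dp_monom a = (\<Prod>i\<in>S. dp_gen i (Poly_Mapping.lookup a i))"
  unfolding dp_monom_def by (intro prod.mono_neutral_left) (auto simp: in_keys_iff dp_gen_0)

lemma dp_monom_single: "dp_monom (Poly_Mapping.single i t) = dp_gen i t"
  by (subst dp_monom_superset[where S = "{i}"]) auto

lemma dp_monom_zero: "dp_monom 0 = 1"
  by (simp add: dp_monom_def)

lemma dp_monom_mult: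
  "(dp_monom a * dp_monom b :: 'k::field divpow) = of_nat (exp_binom a b) * dp_monom (a + b)"
proof -
  let ?S = "Poly_Mapping.keys a \<union> Poly_Mapping.keys b"
  have c: "((x + y) choose y) = ((x + y) choose x)" for x y :: nat
    using binomial_symmetric[of x "x + y"] by simp
  have "Poly_Mapping.keys (a + b) \<subseteq> ?S" by (rule Poly_Mapping.keys_add)
  then show ?thesis
    using dp_monom_superset[of ?S "a + b", where 'a = 'k] dp_monom_superset[of ?S a, where 'a = 'k]
      dp_monom_superset[of ?S b, where 'a = 'k]
    by (simp add: prod.distrib[symmetric] dp_gen_mult lookup_add exp_binom_def c)
qed

lemma dp_monom_add_disjoint:
  assumes "Poly_Mapping.keys a \<inter> Poly_Mapping.keys b = {}"
  shows "dp_monom (a + b) = dp_monom a * dp_monom b"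
proof -
  have "exp_binom a b = 1"
    unfolding exp_binom_def
  proof (intro prod.neutral ballI)
    fix i
    have "Poly_Mapping.lookup a i = 0 \<or> Poly_Mapping.lookup b i = 0"
      using assms by (auto simp: in_keys_iff)
    then show "(Poly_Mapping.lookup a i + Poly_Mapping.lookup b i) choose Poly_Mapping.lookup a i = 1"
      by auto
  qed
  then show ?thesis by (simp add: dp_monom_mult)
qed

text \<open>This is linear independence. The representative \<open>m\<close> uses one generator for
  each variable of \<open>b\<close>, so its \<open>var_fact\<close> is already the full factorial of
  \<open>b\<close> and its \<open>var_coef\<close> is 1. The shift by one is that of the indexing of
  the polynomial variables.\<close>

lemma dp_coef_monom: "dp_coef a (dp_monom b :: 'k::field divpow) = (if a = b then 1 else 0)"
proof -
  define m where "m = (\<lambda>S. \<Sum>i\<in>S. Poly_Mapping.single (i, Poly_Mapping.lookup b i - 1) (1 :: nat))"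
  have "(\<Prod>i\<in>S. dp_gen i (Poly_Mapping.lookup b i) :: 'k divpow) = abs_divpow (Poly_Mapping.single (m S) 1)
      \<and> var_exp (m S) = (\<Sum>i\<in>S. Poly_Mapping.single i (Poly_Mapping.lookup b i))
      \<and> var_fact (m S) = (\<Prod>i\<in>S. fact (Poly_Mapping.lookup b i))"
    if "finite S" "S \<subseteq> Poly_Mapping.keys b" for S
    using that
  proof (induction S rule: finite_induct)
    case empty
    show ?case by (simp add: m_def one_divpow.abs_eq var_exp_def var_fact_def)
  next
    case (insert x S)
    have p: "1 \<le> Poly_Mapping.lookup b x" using insert.prems by (simp add: in_keys_iff Suc_le_eq)
    have m: "m (insert x S) = Poly_Mapping.single (x, Poly_Mapping.lookup b x - 1) 1 + m S"
      using insert.hyps by (simp add: m_def)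
    show ?case
      using insert p unfolding m var_exp_add var_exp_single var_fact_add var_fact_single
      by (simp add: dp_gen_def dp_var_pos times_divpow.abs_eq mult_single)
  qed
  from this[of "Poly_Mapping.keys b"]
  have 1: "(dp_monom b :: 'k divpow) = abs_divpow (Poly_Mapping.single (m (Poly_Mapping.keys b)) 1)"
    and 2: "var_exp (m (Poly_Mapping.keys b))
      = (\<Sum>i\<in>Poly_Mapping.keys b. Poly_Mapping.single i (Poly_Mapping.lookup b i))"
    and 3: "var_fact (m (Poly_Mapping.keys b)) = exp_fact b"
    by (auto simp: dp_monom_def exp_fact_def)
  have 2: "var_exp (m (Poly_Mapping.keys b)) = b"
    unfolding 2 by (rule mpoly_sum_singles[symmetric])
  have "var_coef (m (Poly_Mapping.keys b)) = 1"
    using 2 3 by (intro var_coef_unique) simp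
  then show ?thesis
    unfolding 1 dp_coef.abs_eq mpoly_coef_single 2 by auto
qed

text \<open>By \<open>dp_monom_mult\<close> the span is closed under products; it contains 1 and the
  generators, hence the image of every polynomial.\<close>

lemma dp_span_monom: "(f :: 'k::field divpow) \<in> module.span dp_scale (range dp_monom)"
proof -
  interpret module "dp_scale :: 'k \<Rightarrow> _" by (rule module_dp_scale)
  have mult: "x * y \<in> span (range dp_monom)"
    if x: "x \<in> span (range dp_monom)" and y: "y \<in> span (range dp_monom)" for x y
    using x
  proof (induction rule: span_induct_alt)
    case base
    show ?case by (simp add: span_zero)
  next
    case (step c u v)
    then obtain a where a: "u = dp_monom a" by blast
    have "dp_monom a * y \<in> span (range dp_monom)"
      using y
    proof (induction rule: span_induct_alt)
      case base
      show ?case by (simp add: span_zero)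
    next
      case (step c u v)
      then obtain b where b: "u = dp_monom b" by blast
      have "dp_monom a * dp_scale c u = dp_const c * (dp_monom a * dp_monom b)"
        by (simp add: b dp_scale_def mult_ac)
      also have "\<dots> = dp_scale c (dp_scale (of_nat (exp_binom a b)) (dp_monom (a + b)))"
        by (simp add: dp_monom_mult dp_scale_def unital_hom_of_nat[OF unital_hom_dp_const])
      finally have "dp_monom a * (dp_scale c u + v)
          = dp_scale c (dp_scale (of_nat (exp_binom a b)) (dp_monom (a + b))) + dp_monom a * v"
        by (simp add: distrib_left)
      then show ?case using step by (simp only:) (rule span_add[OF span_scale[OF span_scale[OF span_base[OF rangeI]]]])
    qed
    then have "dp_scale c (u * y) + v * y \<in> span (range dp_monom)"
      using step by (auto simp: a intro!: span_add span_scale)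
    moreover have "(dp_scale c u + v) * y = dp_scale c (u * y) + v * y"
      by (simp add: dp_scale_def distrib_right mult.assoc)
    ultimately show ?case by (simp only:)
  qed
  have one: "1 \<in> span (range dp_monom)"
    using dp_monom_zero by (metis rangeI span_base)
  have gen: "dp_gen i t \<in> span (range dp_monom)" for i t
    using dp_monom_single by (metis rangeI span_base)
  have pow: "x ^ n \<in> span (range dp_monom)" if "x \<in> span (range dp_monom)" for x and n :: nat
    by (induction n) (auto intro: one mult that)
  have prod: "prod F S \<in> span (range dp_monom)" if "\<And>x. x \<in> S \<Longrightarrow> F x \<in> span (range dp_monom)"
    for F :: "nat \<times> nat \<Rightarrow> _" and S
    using that by (induction S rule: infinite_finite_induct) (auto intro: one mult)
  show ?thesis
  proof (induction f rule: divpow.abs_induct)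
    fix F :: "(nat \<times> nat, 'k) mpoly"
    note ha = unital_hom_abs_divpow[where 'k = 'k]
    have "abs_divpow (Poly_Mapping.single m c) \<in> span (range dp_monom)" for m and c :: 'k
    proof -
      have e: "Poly_Mapping.single m c = mpoly_const c * (\<Prod>v\<in>Poly_Mapping.keys m. mpoly_var v ^ Poly_Mapping.lookup m v)"
      proof -
        have pw: "mpoly_var v ^ n = Poly_Mapping.single (Poly_Mapping.single v n) (1 :: 'k)"
          for v :: "nat \<times> nat" and n :: nat
          by (induction n) (auto simp: mpoly_var_def mult_single single_add[symmetric])
        have "(\<Prod>v\<in>S. Poly_Mapping.single (g v) (1 :: 'k)) = Poly_Mapping.single (sum g S) 1"
          if "finite S" for S :: "(nat \<times> nat) set" and g :: "_ \<Rightarrow> (nat \<times> nat \<Rightarrow>\<^sub>0 nat)"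
          using that by (induction S rule: finite_induct) (auto simp: mult_single)
        then show ?thesis
          by (simp add: pw mpoly_const_def mult_single mpoly_sum_singles[symmetric])
      qed
      have am: "abs_divpow (x * y) = abs_divpow x * abs_divpow (y :: (nat \<times> nat, 'k) mpoly)" for x y
        using ha by (simp add: unital_hom_def)
      have ap: "abs_divpow (x ^ n) = abs_divpow (x :: (nat \<times> nat, 'k) mpoly) ^ n" for x and n :: nat
        by (induction n) (auto simp: am one_divpow.abs_eq)
      have apr: "abs_divpow (prod g S) = (\<Prod>v\<in>S. abs_divpow (g v :: (nat \<times> nat, 'k) mpoly))"
        for g and S :: "(nat \<times> nat) set"
        by (induction S rule: infinite_finite_induct) (auto simp: am one_divpow.abs_eq)
      have "abs_divpow (mpoly_var v) = (dp_gen (fst v) (Suc (snd v)) :: 'k divpow)" for v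
        by (simp add: dp_gen_def dp_var_def)
      then show ?thesis
        unfolding e am dp_const_def[symmetric] dp_scale_def[symmetric] apr ap
        by (auto intro!: span_scale prod pow gen)
    qed
    then show "abs_divpow F \<in> span (range dp_monom)"
      by (subst mpoly_sum_singles[of F]) (auto simp: unital_hom_sum[OF ha] intro!: span_sum)
  qed
qed

lemma finite_dp_coef: "finite {a. dp_coef a (f :: 'k::field divpow) \<noteq> 0}" (is ?fin)
  and dp_expand: "f = (\<Sum>a | dp_coef a f \<noteq> 0. dp_scale (dp_coef a f) (dp_monom a))" (is ?eq)
proof -
  interpret module "dp_scale :: 'k \<Rightarrow> _" by (rule module_dp_scale)
  \<comment> \<open>Adding a term may cancel a coefficient, so the induction carries a finite set
    that merely contains the support.\<close>
  have "\<exists>A. finite A \<and> f = (\<Sum>a\<in>A. dp_scale (dp_coef a f) (dp_monom a)) \<and> {a. dp_coef a f \<noteq> 0} \<subseteq> A"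
    using dp_span_monom[of f]
  proof (induction rule: span_induct_alt)
    case base
    show ?case by (intro exI[of _ "{}"]) (auto simp: dp_coef_zero)
  next
    case (step c x y)
    then obtain A b where A: "finite A" "y = (\<Sum>a\<in>A. dp_scale (dp_coef a y) (dp_monom a))"
      "{a. dp_coef a y \<noteq> 0} \<subseteq> A" and x: "x = dp_monom b" by blast
    let ?B = "insert b A"
    have z: "dp_coef a y = 0" if "a \<notin> A" for a using that A(3) by blast
    have "y = (\<Sum>a\<in>?B. dp_scale (dp_coef a y) (dp_monom a))"
      by (subst A(2), rule sum.mono_neutral_left) (use A(1) z in auto)
    moreover have "dp_scale c x = (\<Sum>a\<in>?B. dp_scale (dp_coef a (dp_scale c x)) (dp_monom a))"
      using A(1) by (subst sum.remove[of _ b]) (auto simp: x dp_coef_scale dp_coef_monom)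
    ultimately have e: "dp_scale c x + y
        = (\<Sum>a\<in>?B. dp_scale (dp_coef a (dp_scale c x + y)) (dp_monom a))"
      by (simp only: dp_coef_add scale_left_distrib sum.distrib)
    have "{a. dp_coef a (dp_scale c x + y) \<noteq> 0} \<subseteq> ?B"
      using z by (auto simp: dp_coef_add dp_coef_scale dp_coef_monom x)
    with e A(1) show ?case by blast
  qed
  then obtain A where A: "finite A" "f = (\<Sum>a\<in>A. dp_scale (dp_coef a f) (dp_monom a))"
    "{a. dp_coef a f \<noteq> 0} \<subseteq> A" by blast
  then show ?fin using finite_subset by blast
  have "(\<Sum>a | dp_coef a f \<noteq> 0. dp_scale (dp_coef a f) (dp_monom a))
      = (\<Sum>a\<in>A. dp_scale (dp_coef a f) (dp_monom a))"
    using A by (intro sum.mono_neutral_left) auto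
  with A(2) show ?eq by simp
qed

lemma dp_const_mult: "dp_const (x * y) = dp_const x * dp_const y"
  and dp_const_one: "dp_const 1 = 1"
  and dp_const_zero: "dp_const 0 = 0"
  using unital_hom_dp_const unital_hom_zero[OF unital_hom_dp_const] by (auto simp: unital_hom_def)

lemma dp_scale_one: "dp_scale 1 f = f"
  by (simp add: dp_scale_def dp_const_one)

lemma divpow_hom_eqI:
  assumes h: "unital_hom (h :: 'k::field divpow \<Rightarrow> 'b::comm_ring_1)" and h': "unital_hom h'"
    and const: "\<And>c. h (dp_const c) = h' (dp_const c)"
    and gen: "\<And>i t. 1 \<le> t \<Longrightarrow> h (dp_gen i t) = h' (dp_gen i t)"
  shows "h f = h' f"
proof -
  have gen: "h (dp_gen i t) = h' (dp_gen i t)" for i t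
    using gen[of t i] h h' by (cases t) (auto simp: dp_gen_0 unital_hom_def)
  have prod: "f (prod F S) = (\<Prod>x\<in>S. f (F x))" if "unital_hom f"
    for f :: "'k divpow \<Rightarrow> 'b" and F :: "nat \<Rightarrow> 'k divpow" and S
    using that by (induction S rule: infinite_finite_induct) (auto simp: unital_hom_def)
  have scale: "h (dp_scale c (dp_monom a)) = h' (dp_scale c (dp_monom a))" for c a
  proof -
    have "h (dp_monom a) = h' (dp_monom a)"
      by (simp add: dp_monom_def prod[OF h] prod[OF h'] gen)
    then show ?thesis using h h' const by (simp add: dp_scale_def unital_hom_def)
  qed
  show ?thesis
    by (subst (1 2) dp_expand[of f]) (simp add: unital_hom_sum[OF h] unital_hom_sum[OF h'] scale)
qed

section \<open>The grading\<close>

definition exp_degree :: "(nat \<Rightarrow>\<^sub>0 nat) \<Rightarrow> nat" where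
  "exp_degree a = (\<Sum>i\<in>Poly_Mapping.keys a. Poly_Mapping.lookup a i)"

lemma exp_degree_add: "exp_degree (a + b) = exp_degree a + exp_degree b"
  unfolding exp_degree_def by (rule setsum_keys_plus_distrib) auto

lemma exp_degree_single: "exp_degree (Poly_Mapping.single i t) = t"
  by (simp add: exp_degree_def)

lemma exp_degree_eq_0: "exp_degree a = 0 \<longleftrightarrow> a = 0"
  by (auto simp: exp_degree_def in_keys_iff poly_mapping_eq_iff fun_eq_iff)

lemma lookup_le_exp_degree: "Poly_Mapping.lookup a i \<le> exp_degree a"
  unfolding exp_degree_def
  by (cases "i \<in> Poly_Mapping.keys a") (auto intro: member_le_sum simp: in_keys_iff)

text \<open>Links the grading through homogeneous representatives with the grading by exponents of
  divided monomials.\<close>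

lemma dp_weight_eq: "dp_weight m = exp_degree (var_exp m)"
proof -
  have "exp_degree (sum F S) = (\<Sum>x\<in>S. exp_degree (F x))" for F :: "nat \<times> nat \<Rightarrow> _" and S
    by (induction S rule: infinite_finite_induct) (auto simp: exp_degree_add, auto simp: exp_degree_def)
  then show ?thesis
    by (auto simp: dp_weight_def var_exp_def exp_degree_single case_prod_beta)
qed

lemma dp_weight_add: "dp_weight (m + n) = dp_weight m + dp_weight n"
  by (simp add: dp_weight_eq var_exp_add exp_degree_add)

lemma dp_coef_degree_part: "f \<in> dp_degree_part d \<Longrightarrow> dp_coef a f \<noteq> 0 \<Longrightarrow> exp_degree a = d"
  unfolding dp_degree_part_def
  by (auto simp: dp_coef.abs_eq mpoly_coef_def dp_weight_eq elim!: sum.not_neutral_contains_not_neutral split: if_splits)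

lemma dp_degree_part_zero: "0 \<in> dp_degree_part d"
  unfolding dp_degree_part_def zero_divpow.abs_eq by (rule imageI) auto

lemma dp_degree_part_add:
  "f \<in> dp_degree_part d \<Longrightarrow> g \<in> dp_degree_part d \<Longrightarrow> f + g \<in> dp_degree_part d"
proof -
  assume "f \<in> dp_degree_part d" "g \<in> dp_degree_part d"
  then obtain F G where "f = abs_divpow F" "\<forall>m\<in>Poly_Mapping.keys F. dp_weight m = d"
    "g = abs_divpow G" "\<forall>m\<in>Poly_Mapping.keys G. dp_weight m = d"
    unfolding dp_degree_part_def by blast
  then show ?thesis
    unfolding dp_degree_part_def using Poly_Mapping.keys_add[of F G]
    by (auto simp: plus_divpow.abs_eq intro!: imageI)
qed

lemma dp_degree_part_sum:
  "(\<And>x. x \<in> S \<Longrightarrow> F x \<in> dp_degree_part d) \<Longrightarrow> sum F S \<in> dp_degree_part d"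
  by (induction S rule: infinite_finite_induct) (auto simp: dp_degree_part_zero dp_degree_part_add)

lemma dp_degree_part_mult:
  "f \<in> dp_degree_part d \<Longrightarrow> g \<in> dp_degree_part e \<Longrightarrow> f * g \<in> dp_degree_part (d + e)"
proof -
  assume "f \<in> dp_degree_part d" "g \<in> dp_degree_part e"
  then obtain F G where "f = abs_divpow F" "\<forall>m\<in>Poly_Mapping.keys F. dp_weight m = d"
    "g = abs_divpow G" "\<forall>m\<in>Poly_Mapping.keys G. dp_weight m = e"
    unfolding dp_degree_part_def by blast
  then show ?thesis
    unfolding dp_degree_part_def using Poly_Mapping.keys_mult[of F G]
    by (fastforce simp: times_divpow.abs_eq dp_weight_add intro!: imageI)
qed

lemma dp_degree_part_const: "dp_const c \<in> dp_degree_part 0"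
  unfolding dp_degree_part_def dp_const_def mpoly_const_def
  by (rule imageI) (auto simp: dp_weight_def split: if_splits)

lemma dp_degree_part_gen: "dp_gen i t \<in> dp_degree_part t"
proof (cases t)
  case 0
  then show ?thesis
    using dp_degree_part_const[of 1] by (simp add: dp_gen_0 dp_const_one)
next
  case (Suc s)
  then show ?thesis
    unfolding dp_degree_part_def dp_gen_def
    by (intro imageI) (auto simp: dp_var_pos dp_weight_eq var_exp_single exp_degree_single)
qed

lemma dp_degree_part_scale: "f \<in> dp_degree_part d \<Longrightarrow> dp_scale c f \<in> dp_degree_part d"
  using dp_degree_part_mult[OF dp_degree_part_const] by (fastforce simp: dp_scale_def)

lemma dp_degree_part_prod:
  "finite S \<Longrightarrow> (\<And>x. x \<in> S \<Longrightarrow> F x \<in> dp_degree_part (d x)) \<Longrightarrow> prod F S \<in> dp_degree_part (sum d S)"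
proof (induction S rule: finite_induct)
  case empty
  show ?case using dp_degree_part_gen[of 0 0] by (simp add: dp_gen_0)
qed (auto intro: dp_degree_part_mult)

lemma dp_degree_part_monom: "dp_monom a \<in> dp_degree_part (exp_degree a)"
  unfolding dp_monom_def exp_degree_def by (rule dp_degree_part_prod) (auto intro: dp_degree_part_gen)

lemma dp_power_degree: "dp_power v t \<in> dp_degree_part t"
  unfolding dp_power_def
proof (rule dp_degree_part_sum)
  fix a assume "a \<in> exponents (Poly_Mapping.keys v) t"
  then have "t = sum a (Poly_Mapping.keys v)" by (simp add: exponents_def)
  then show "(\<Prod>j\<in>Poly_Mapping.keys v. dp_scale (Poly_Mapping.lookup v j ^ a j) (dp_gen j (a j)))
      \<in> dp_degree_part t"
    by (auto intro!: dp_degree_part_prod dp_degree_part_scale dp_degree_part_gen)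
qed

section \<open>Divided powers of vectors\<close>

text \<open>The generating series of the divided powers of a vector turns sums into products.\<close>

definition dp_series :: "'k::field vec \<Rightarrow> 'k divpow fps" where
  "dp_series v = Abs_fps (dp_power v)"

definition dp_gen_series :: "nat \<Rightarrow> 'k::field \<Rightarrow> 'k divpow fps" where
  "dp_gen_series j c = Abs_fps (\<lambda>t. dp_scale (c ^ t) (dp_gen j t))"

text \<open>Identifies the finite sum that defines \<open>dp_power\<close> with a coefficient of a
  product of power series, one factor for each basis vector.\<close>

lemma fps_prod_nth_exponents:
  "finite S \<Longrightarrow> fps_nth (\<Prod>j\<in>S. F j) t = (\<Sum>a\<in>exponents S t. \<Prod>j\<in>S. fps_nth (F j) (a j))"
proof (induction S arbitrary: t rule: finite_induct)
  case empty
  have "exponents {} t = (if t = 0 then {\<lambda>_. 0} else {})" by (auto simp: exponents_def)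
  then show ?case by simp
next
  case (insert x S)
  have p: "(\<Prod>j\<in>S. fps_nth (F j) ((a(x := u)) j)) = (\<Prod>j\<in>S. fps_nth (F j) (a j))" for a u
    using insert.hyps by (intro prod.cong) auto
  have "(\<Sum>a\<in>exponents (insert x S) t. \<Prod>j\<in>insert x S. fps_nth (F j) (a j))
      = (\<Sum>(u, a)\<in>(SIGMA u:{..t}. exponents S (t - u)). fps_nth (F x) u * (\<Prod>j\<in>S. fps_nth (F j) (a j)))"
    using insert.hyps p
    by (subst sum.reindex_bij_betw[OF exponents_insert[OF insert.hyps], symmetric])
      (auto intro!: sum.cong)
  also have "\<dots> = (\<Sum>u\<le>t. fps_nth (F x) u * fps_nth (\<Prod>j\<in>S. F j) (t - u))"
    using insert.hyps
    by (subst sum.Sigma[symmetric]) (auto simp: finite_exponents insert.IH sum_distrib_left)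
  also have "\<dots> = fps_nth (\<Prod>j\<in>insert x S. F j) t"
    using insert.hyps by (simp add: fps_mult_nth atLeast0AtMost)
  finally show ?case ..
qed

lemma dp_gen_series_0: "dp_gen_series j 0 = 1"
  by (intro fps_ext)
    (auto simp: dp_gen_series_def dp_scale_def dp_gen_0 dp_const_one dp_const_zero power_0_left)

text \<open>The series is formally \<open>exp (c x_j T)\<close>, and this is the exponential law:
  multiplying divided powers of \<open>x_j\<close> yields the coefficients of the binomial
  theorem.\<close>

lemma dp_gen_series_add: "dp_gen_series j (c + d) = dp_gen_series j c * (dp_gen_series j d :: 'k::field divpow fps)"
proof (rule fps_ext)
  fix t
  note u = unital_hom_dp_const[where 'k = 'k]
  have "fps_nth (dp_gen_series j c * dp_gen_series j d) t
      = (\<Sum>s\<le>t. dp_scale (c ^ s) (dp_gen j s) * dp_scale (d ^ (t - s)) (dp_gen j (t - s)))"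
    by (simp add: fps_mult_nth atLeast0AtMost dp_gen_series_def)
  also have "\<dots> = (\<Sum>s\<le>t. dp_const (of_nat (t choose s) * c ^ s * d ^ (t - s)) * dp_gen j t)"
  proof (rule sum.cong[OF refl])
    fix s assume "s \<in> {..t}"
    then have "s \<le> t" by simp
    then have "dp_gen j s * dp_gen j (t - s) = (of_nat (t choose s) * dp_gen j t :: 'k divpow)"
      using dp_gen_mult[of j s "t - s", where 'k = 'k] binomial_symmetric[of s t] by simp
    moreover have "dp_scale (c ^ s) (dp_gen j s) * dp_scale (d ^ (t - s)) (dp_gen j (t - s))
        = dp_const (c ^ s) * dp_const (d ^ (t - s)) * (dp_gen j s * dp_gen j (t - s))"
      by (simp add: dp_scale_def mult_ac)
    ultimately show "dp_scale (c ^ s) (dp_gen j s) * dp_scale (d ^ (t - s)) (dp_gen j (t - s))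
        = dp_const (of_nat (t choose s) * c ^ s * d ^ (t - s)) * dp_gen j t"
      by (simp add: dp_const_mult unital_hom_of_nat[OF u] mult_ac)
  qed
  also have "\<dots> = dp_scale ((c + d) ^ t) (dp_gen j t)"
    by (simp add: binomial_ring unital_hom_sum[OF u] dp_scale_def sum_distrib_right)
  finally show "fps_nth (dp_gen_series j (c + d)) t = fps_nth (dp_gen_series j c * dp_gen_series j d) t"
    by (simp add: dp_gen_series_def)
qed

lemma dp_series_superset:
  assumes "finite S" "Poly_Mapping.keys v \<subseteq> S"
  shows "dp_series v = (\<Prod>j\<in>S. dp_gen_series j (Poly_Mapping.lookup v j))"
proof -
  have "dp_series v = (\<Prod>j\<in>Poly_Mapping.keys v. dp_gen_series j (Poly_Mapping.lookup v j))"
    by (rule fps_ext) (simp add: fps_prod_nth_exponents dp_series_def dp_power_def dp_gen_series_def)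
  also have "\<dots> = (\<Prod>j\<in>S. dp_gen_series j (Poly_Mapping.lookup v j))"
    using assms by (intro prod.mono_neutral_left) (auto simp: in_keys_iff dp_gen_series_0)
  finally show ?thesis .
qed

lemma dp_series_add: "dp_series (v + w) = dp_series v * dp_series w"
proof -
  let ?S = "Poly_Mapping.keys v \<union> Poly_Mapping.keys w"
  have "Poly_Mapping.keys (v + w) \<subseteq> ?S" by (rule Poly_Mapping.keys_add)
  then show ?thesis
    using dp_series_superset[of ?S "v + w"] dp_series_superset[of ?S v] dp_series_superset[of ?S w]
    by (simp add: lookup_add dp_gen_series_add prod.distrib)
qed

lemma dp_series_zero: "dp_series 0 = 1"
  by (subst dp_series_superset[of "{}"]) auto

lemma dp_series_sum: "dp_series (sum F S) = (\<Prod>x\<in>S. dp_series (F x))"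
  by (induction S rule: infinite_finite_induct) (auto simp: dp_series_add dp_series_zero)

lemma dp_power_add: "dp_power (v + w) t = (\<Sum>s\<le>t. dp_power v s * dp_power w (t - s))"
  using arg_cong[OF dp_series_add[of v w], of "\<lambda>F. fps_nth F t"]
  by (simp add: dp_series_def fps_mult_nth atLeast0AtMost)

lemma dp_power_single: "dp_power (Poly_Mapping.single i c) t = dp_scale (c ^ t) (dp_gen i t)"
  using arg_cong[OF dp_series_superset[of "{i}" "Poly_Mapping.single i c"], of "\<lambda>F. fps_nth F t"]
  by (simp add: dp_series_def dp_gen_series_def)

lemma dp_power_basis: "dp_power (vec_basis i) t = dp_gen i t"
  by (simp add: vec_basis_def dp_power_single dp_scale_one)

lemma dp_power_0: "dp_power v 0 = 1"
proof -
  have "exponents (Poly_Mapping.keys v) 0 = {\<lambda>_. 0}"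
    by (auto simp: exponents_def fun_eq_iff)
  then show ?thesis by (simp add: dp_power_def dp_gen_0 dp_scale_one)
qed

lemma lookup_vec_scale: "Poly_Mapping.lookup (vec_scale c v) i = c * Poly_Mapping.lookup v i"
  by (simp add: vec_scale_def map.rep_eq when_def)

lemma dp_power_vec_scale: "dp_power (vec_scale c v) t = dp_scale (c ^ t) (dp_power v t :: 'k::field divpow)"
proof -
  let ?S = "Poly_Mapping.keys v"
  have "Poly_Mapping.keys (vec_scale c v) \<subseteq> ?S" by (auto simp: in_keys_iff lookup_vec_scale)
  then have "dp_series (vec_scale c v) = (\<Prod>j\<in>?S. dp_gen_series j (c * Poly_Mapping.lookup v j))"
    using dp_series_superset[of ?S "vec_scale c v"] by (simp add: lookup_vec_scale)
  then have "fps_nth (dp_series (vec_scale c v)) t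
      = fps_nth (\<Prod>j\<in>?S. dp_gen_series j (c * Poly_Mapping.lookup v j)) t"
    by simp
  then have "dp_power (vec_scale c v) t = (\<Sum>a\<in>exponents ?S t. \<Prod>j\<in>?S.
      dp_scale ((c * Poly_Mapping.lookup v j) ^ a j) (dp_gen j (a j)))"
    by (simp add: dp_series_def fps_prod_nth_exponents dp_gen_series_def)
  also have "\<dots> = (\<Sum>a\<in>exponents ?S t. dp_const (c ^ t) * (\<Prod>j\<in>?S.
      dp_scale (Poly_Mapping.lookup v j ^ a j) (dp_gen j (a j))))"
  proof (rule sum.cong[OF refl])
    fix a assume "a \<in> exponents ?S t"
    then have t: "sum a ?S = t" by (simp add: exponents_def)
    have p: "(\<Prod>j\<in>S. dp_const (c ^ a j)) = (dp_const (c ^ sum a S) :: 'k divpow)" if "finite S" for S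
      using that
      by (induction S rule: finite_induct) (auto simp: power_add dp_const_mult dp_const_one)
    show "(\<Prod>j\<in>?S. dp_scale ((c * Poly_Mapping.lookup v j) ^ a j) (dp_gen j (a j)))
        = dp_const (c ^ t) * (\<Prod>j\<in>?S. dp_scale (Poly_Mapping.lookup v j ^ a j) (dp_gen j (a j)))"
      using p[of ?S] by (simp add: t dp_scale_def power_mult_distrib dp_const_mult mult.assoc prod.distrib)
  qed
  also have "\<dots> = dp_scale (c ^ t) (dp_power v t)"
    by (simp add: dp_power_def dp_scale_def sum_distrib_left)
  finally show ?thesis .
qed

section \<open>The action\<close>

lemma gl_act_scale: "gl_act g (dp_scale c f) = dp_scale c (gl_act g f)"
  using unital_hom_gl_act[of g] by (simp add: dp_scale_def unital_hom_def gl_act_const)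

lemma gl_act_mult: "gl_act g (x * y) = gl_act g x * gl_act g y"
  and gl_act_add: "gl_act g (x + y) = gl_act g x + gl_act g y"
  and gl_act_one: "gl_act g 1 = 1"
  using unital_hom_gl_act[of g] by (auto simp: unital_hom_def)

lemma gl_act_sum: "gl_act g (sum F S) = (\<Sum>x\<in>S. gl_act g (F x))"
  by (rule unital_hom_sum[OF unital_hom_gl_act])

lemma gl_act_prod: "gl_act g (prod F S) = (\<Prod>x\<in>S. gl_act g (F x))"
  by (induction S rule: infinite_finite_induct) (auto simp: gl_act_mult gl_act_one)

lemma gl_act_gen_power: "gl_act g (dp_gen i t) = dp_power (g (vec_basis i)) t"
  by (cases "t = 0") (auto simp: dp_gen_0 gl_act_one dp_power_0 gl_act_gen)

text \<open>The action prescribes this only for basis vectors; the extension to all vectors is what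
  makes it compatible with composition. Acting on coefficients is a ring homomorphism
  \<open>G\<close> of power series, so the product formula for \<open>dp_series\<close> reduces the
  claim to multiples of basis vectors.\<close>

lemma gl_act_power:
  fixes g :: "'k::field vec \<Rightarrow> 'k vec"
  assumes g: "Vector_Spaces.linear vec_scale vec_scale g"
  shows "gl_act g (dp_power v t) = dp_power (g v) t"
proof -
  interpret Vector_Spaces.linear vec_scale vec_scale g by (rule g)
  define G where "G = (\<lambda>F. Abs_fps (\<lambda>t. gl_act g (fps_nth F t)))"
  have G1: "G 1 = 1"
    using unital_hom_zero[OF unital_hom_gl_act[of g]]
    by (intro fps_ext) (auto simp: G_def gl_act_one)
  have Gm: "G (x * y) = G x * G y" for x y
    by (rule fps_ext) (simp add: G_def fps_mult_nth gl_act_sum gl_act_mult)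
  have Gp: "G (prod F S) = (\<Prod>x\<in>S. G (F x))" for F and S :: "nat set"
    by (induction S rule: infinite_finite_induct) (auto simp: G1 Gm)
  have "G (dp_gen_series j c) = dp_series (g (Poly_Mapping.single j c))" for j c
  proof -
    have "Poly_Mapping.single j c = vec_scale c (vec_basis j)"
      by (rule poly_mapping_eqI) (simp add: vec_basis_def lookup_vec_scale lookup_single when_def)
    then have "g (Poly_Mapping.single j c) = vec_scale c (g (vec_basis j))"
      by (simp add: scale)
    then show ?thesis
      by (intro fps_ext)
        (simp add: G_def dp_gen_series_def dp_series_def gl_act_scale gl_act_gen_power dp_power_vec_scale)
  qed
  then have "G (dp_series v)
      = (\<Prod>j\<in>Poly_Mapping.keys v. dp_series (g (Poly_Mapping.single j (Poly_Mapping.lookup v j))))"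
    by (subst dp_series_superset[of "Poly_Mapping.keys v"]) (auto simp: Gp)
  also have "\<dots> = dp_series (g (\<Sum>j\<in>Poly_Mapping.keys v. Poly_Mapping.single j (Poly_Mapping.lookup v j)))"
    by (simp add: dp_series_sum sum)
  finally have "G (dp_series v) = dp_series (g v)"
    by (simp add: mpoly_sum_singles[symmetric])
  then have "fps_nth (G (dp_series v)) t = fps_nth (dp_series (g v)) t" by simp
  then show ?thesis by (simp add: G_def dp_series_def)
qed

lemma gl_act_comp:
  assumes "Vector_Spaces.linear vec_scale vec_scale g"
  shows "gl_act g (gl_act h f) = gl_act (g \<circ> h) f"
proof (rule divpow_hom_eqI[where h = "\<lambda>f. gl_act g (gl_act h f)"])
  show "unital_hom (\<lambda>f. gl_act g (gl_act h f))"
    by (simp add: unital_hom_def gl_act_one gl_act_add gl_act_mult)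
  show "unital_hom (gl_act (g \<circ> h))" by (rule unital_hom_gl_act)
qed (simp_all add: gl_act_const gl_act_gen gl_act_power[OF assms])

lemma gl_act_id: "gl_act id f = f"
  by (rule divpow_hom_eqI) (auto simp: unital_hom_gl_act gl_act_const gl_act_gen dp_power_basis,
    simp add: unital_hom_def)

lemma GL_linear: "g \<in> GL \<Longrightarrow> Vector_Spaces.linear vec_scale vec_scale g"
  by (simp add: GL_def)

lemma GL_inv:
  assumes "g \<in> GL"
  shows "inv g \<in> GL"
proof -
  have b: "bij g" and f: "finite {i. g (vec_basis i) \<noteq> vec_basis i}"
    using assms by (auto simp: GL_def)
  interpret Vector_Spaces.linear vec_scale vec_scale g by (rule GL_linear[OF assms])
  have s: "g (inv g x) = x" for x using b by (simp add: bij_is_surj surj_f_inv_f)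
  have i: "inv g x = y \<longleftrightarrow> x = g y" for x y using b s by (metis bij_inv_eq_iff)
  have "Vector_Spaces.linear vec_scale vec_scale (inv g)"
    using vector_space_vec_scale by (auto simp: Vector_Spaces.linear_iff i add scale s)
  moreover have "{i. inv g (vec_basis i) \<noteq> vec_basis i} = {i. g (vec_basis i) \<noteq> vec_basis i}"
    by (metis i)
  ultimately show ?thesis
    using b f by (simp add: GL_def bij_imp_bij_inv)
qed

lemma gl_act_inv: "g \<in> GL \<Longrightarrow> gl_act g (gl_act (inv g) f) = f"
proof -
  assume g: "g \<in> GL"
  then have "g \<circ> inv g = id" by (auto simp: GL_def bij_is_surj surj_f_inv_f)
  then show ?thesis using gl_act_comp[OF GL_linear[OF g], of "inv g" f] by (simp add: gl_act_id)
qed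

text \<open>One formula for two kinds of matrices: for distinct indices a transvection, for
  \<open>n = j\<close> the diagonal matrix scaling the basis vector \<open>n\<close> by
  \<open>1 + c\<close>. Hence the parameter \<open>c - 1\<close> wherever a scaling by
  \<open>c\<close> is meant.\<close>

definition elementary :: "nat \<Rightarrow> nat \<Rightarrow> 'k::field \<Rightarrow> 'k vec \<Rightarrow> 'k vec" where
  "elementary n j c v = v + Poly_Mapping.single j (c * Poly_Mapping.lookup v n)"

lemma elementary_basis:
  "elementary n j c (vec_basis i) = (if i = n then vec_basis n + Poly_Mapping.single j c else vec_basis i)"
  by (auto simp: elementary_def vec_basis_def lookup_single when_def)

lemma elementary_inverse:
  assumes "c + d + (if n = j then c * d else 0) = 0"
  shows "elementary n j c (elementary n j d v) = v"
proof (rule poly_mapping_eqI)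
  fix k
  have "(c + d + (if n = j then c * d else 0)) * Poly_Mapping.lookup v n = 0"
    using assms by simp
  then show "Poly_Mapping.lookup (elementary n j c (elementary n j d v)) k = Poly_Mapping.lookup v k"
    by (auto simp: elementary_def lookup_add lookup_single when_def algebra_simps split: if_splits)
qed

lemma elementary_GL:
  assumes "n = j \<Longrightarrow> 1 + c \<noteq> 0"
  shows "elementary n j c \<in> GL"
proof -
  \<comment> \<open>The inverse parameter: in the diagonal case it solves
    \<open>(1 + c) * (1 + d) = 1\<close>.\<close>
  define d where "d = (if n = j then - c / (1 + c) else - c)"
  have "c + d + (if n = j then c * d else 0) = 0" "d + c + (if n = j then d * c else 0) = 0"
  proof -
    have "c + (1 + c) * d = 0" if "n = j" using assms that by (simp add: d_def)
    then have "c + d + (if n = j then c * d else 0) = 0"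
      by (cases "n = j") (simp_all add: distrib_right add.assoc, simp add: d_def)
    then show "c + d + (if n = j then c * d else 0) = 0" "d + c + (if n = j then d * c else 0) = 0"
      by (simp_all only: add.commute mult.commute)
  qed
  then have "elementary n j c \<circ> elementary n j d = id" "elementary n j d \<circ> elementary n j c = id"
    using elementary_inverse by (fastforce simp: fun_eq_iff)+
  then have "bij (elementary n j c)" using o_bij by blast
  moreover have "Vector_Spaces.linear vec_scale vec_scale (elementary n j c)"
    using vector_space_vec_scale
    by (auto simp: Vector_Spaces.linear_iff elementary_def lookup_vec_scale lookup_add
        distrib_left single_add intro!: poly_mapping_eqI)
      (auto simp: lookup_add lookup_vec_scale lookup_single when_def algebra_simps)
  moreover have "finite {i. elementary n j c (vec_basis i) \<noteq> vec_basis i}"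
    by (rule finite_subset[of _ "{n}"]) (auto simp: elementary_basis)
  ultimately show ?thesis by (simp add: GL_def)
qed

lemma elementary_gen_other: "i \<noteq> n \<Longrightarrow> gl_act (elementary n j c) (dp_gen i t) = dp_gen i t"
  by (simp add: gl_act_gen_power elementary_basis dp_power_basis)

lemma elementary_gen_diag: "gl_act (elementary n n (c - 1)) (dp_gen n t) = dp_scale (c ^ t) (dp_gen n t)"
proof -
  have "vec_basis n + Poly_Mapping.single n (c - 1) = Poly_Mapping.single n c"
    by (simp add: vec_basis_def single_add[symmetric])
  then show ?thesis by (simp add: gl_act_gen_power elementary_basis dp_power_single)
qed

lemma elementary_gen_transvection:
  "gl_act (elementary n j 1) (dp_gen n t) = (\<Sum>s\<le>t. dp_gen n s * dp_gen j (t - s))"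
  by (simp add: gl_act_gen_power elementary_basis dp_power_add dp_power_single dp_power_basis dp_scale_one)

lemma elementary_monom_other:
  "n \<notin> Poly_Mapping.keys a \<Longrightarrow> gl_act (elementary n j c) (dp_monom a) = dp_monom a"
  by (auto simp: dp_monom_def gl_act_prod intro!: prod.cong elementary_gen_other)

lemma elementary_monom_diag:
  "gl_act (elementary n n (c - 1)) (dp_monom a) = dp_scale (c ^ Poly_Mapping.lookup a n) (dp_monom a)"
proof -
  define b where "b = Poly_Mapping.update n 0 a"
  have a: "a = Poly_Mapping.single n (Poly_Mapping.lookup a n) + b"
    by (rule poly_mapping_eqI) (auto simp: b_def lookup_add lookup_single lookup_update when_def)
  have n: "n \<notin> Poly_Mapping.keys b" by (simp add: b_def in_keys_iff lookup_update)
  have e: "dp_monom a = dp_gen n (Poly_Mapping.lookup a n) * dp_monom b"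
    by (subst a, subst dp_monom_add_disjoint) (use n in \<open>auto simp: dp_monom_single\<close>)
  show ?thesis
    using n by (simp add: e gl_act_mult elementary_gen_diag elementary_monom_other dp_scale_def mult_ac)
qed

section \<open>Equivariant ideals are monomial\<close>

lemma infinite_alg_closed_field: "infinite (UNIV :: 'k::alg_closed_field set)"
proof
  assume f: "finite (UNIV :: 'k set)"
  define P where "P = (\<Prod>c\<in>(UNIV :: 'k set). [:- c, 1:])"
  have "degree P = card (UNIV :: 'k set)"
    unfolding P_def by (subst degree_prod_eq_sum_degree) auto
  then have "degree P > 0" using f by (simp add: card_gt_0_iff)
  then have "degree (P + 1) > 0" by (simp add: degree_add_eq_left)
  then obtain z where "poly (P + 1) z = 0" using alg_closed_imp_poly_has_root by blast
  moreover have "poly P z = 0" using f by (auto simp: P_def poly_prod)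
  ultimately show False by simp
qed

lemma separating_power:
  assumes "m \<noteq> n"
  shows "\<exists>c :: 'k::alg_closed_field. c \<noteq> 0 \<and> c ^ m \<noteq> c ^ n"
proof -
  \<comment> \<open>The extra factor \<open>X\<close> makes 0 a root, so that any non-root is
    nonzero as well.\<close>
  define P where "P = (monom 1 (Suc m) - monom 1 (Suc n) :: 'k poly)"
  have "coeff P (Suc m) = 1" using assms by (simp add: P_def)
  then have "P \<noteq> 0" by auto
  then have "finite {x. poly P x = 0}" by (rule poly_roots_finite)
  then obtain c where "poly P c \<noteq> 0" using infinite_alg_closed_field[where 'k = 'k]
    by (metis (mono_tags, lifting) Collect_cong UNIV_def)
  then show ?thesis by (intro exI[of _ c]) (auto simp: P_def poly_monom)
qed

context
  fixes P :: "'k::field divpow set"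
  assumes P: "gl_ideal P"
begin

lemma gl_ideal_zero: "0 \<in> P"
  and gl_ideal_add: "\<And>x y. x \<in> P \<Longrightarrow> y \<in> P \<Longrightarrow> x + y \<in> P"
  and gl_ideal_mult: "\<And>x y. y \<in> P \<Longrightarrow> x * y \<in> P"
  and gl_ideal_act: "\<And>g x. g \<in> GL \<Longrightarrow> x \<in> P \<Longrightarrow> gl_act g x \<in> P"
  using P by (auto simp: gl_ideal_def ring_ideal_def image_subset_iff)

lemma gl_ideal_scale: "x \<in> P \<Longrightarrow> dp_scale c x \<in> P"
  by (simp add: dp_scale_def gl_ideal_mult)

lemma gl_ideal_diff: "x \<in> P \<Longrightarrow> y \<in> P \<Longrightarrow> x - y \<in> P"
  using gl_ideal_add[of x "- 1 * y"] gl_ideal_mult[of y "- 1"] by simp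

lemma gl_ideal_sum: "(\<And>x. x \<in> S \<Longrightarrow> F x \<in> P) \<Longrightarrow> sum F S \<in> P"
  by (induction S rule: infinite_finite_induct) (auto simp: gl_ideal_zero gl_ideal_add)

lemma gl_ideal_from_monoms: "(\<And>a. dp_coef a f \<noteq> 0 \<Longrightarrow> dp_monom a \<in> P) \<Longrightarrow> f \<in> P"
  by (subst dp_expand[of f]) (auto intro!: gl_ideal_sum gl_ideal_scale)

end

lemma dp_coef_diag:
  "dp_coef a (gl_act (elementary n n (c - 1)) f) = c ^ Poly_Mapping.lookup a n * dp_coef a (f :: 'k::field divpow)"
proof -
  have "dp_coef a (gl_act (elementary n n (c - 1)) f)
      = (\<Sum>b | dp_coef b f \<noteq> 0. dp_coef b f * (c ^ Poly_Mapping.lookup b n * (if a = b then 1 else 0)))"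
    by (subst dp_expand[of f])
      (simp add: gl_act_sum gl_act_scale elementary_monom_diag dp_coef_sum dp_coef_scale dp_coef_monom)
  also have "\<dots> = (\<Sum>b | dp_coef b f \<noteq> 0. if a = b then c ^ Poly_Mapping.lookup a n * dp_coef a f else 0)"
    by (rule sum.cong) auto
  finally show ?thesis by (auto simp: finite_dp_coef)
qed

text \<open>The weight spaces of the diagonal torus are spanned by single monomials, and any two weights
  are separated by an element scaling one coordinate.\<close>

lemma gl_ideal_monom:
  fixes P :: "'k::alg_closed_field divpow set"
  assumes P: "gl_ideal P" and "f \<in> P" "dp_coef a f \<noteq> 0"
  shows "dp_monom a \<in> P"
  using assms(2,3)
proof (induction "card {b. dp_coef b f \<noteq> 0}" arbitrary: f rule: less_induct)
  case less
  show ?case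
  proof (cases "\<exists>b. b \<noteq> a \<and> dp_coef b f \<noteq> 0")
    case True
    then obtain b where b: "b \<noteq> a" "dp_coef b f \<noteq> 0" by blast
    then obtain i where "Poly_Mapping.lookup a i \<noteq> Poly_Mapping.lookup b i"
      by (metis poly_mapping_eqI)
    then obtain c :: 'k where c: "c \<noteq> 0" "c ^ Poly_Mapping.lookup a i \<noteq> c ^ Poly_Mapping.lookup b i"
      using separating_power by metis
    \<comment> \<open>Subtracting the eigenvalue at \<open>b\<close> removes that monomial and
      creates no new one, while the coefficient at \<open>a\<close> is multiplied by a nonzero
      scalar.\<close>
    define h where "h = gl_act (elementary i i (c - 1)) f - dp_scale (c ^ Poly_Mapping.lookup b i) f"
    have "elementary i i (c - 1) \<in> GL" using c by (intro elementary_GL) simp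
    then have h: "h \<in> P"
      unfolding h_def using less.prems
      by (intro gl_ideal_diff[OF P] gl_ideal_act[OF P] gl_ideal_scale[OF P])
    have e: "dp_coef e h = (c ^ Poly_Mapping.lookup e i - c ^ Poly_Mapping.lookup b i) * dp_coef e f" for e
      by (simp add: h_def dp_coef_diff dp_coef_diag dp_coef_scale algebra_simps)
    have "{e. dp_coef e h \<noteq> 0} \<subset> {e. dp_coef e f \<noteq> 0}" using b by (auto simp: e)
    then show ?thesis
      using less.hyps[of h] less.prems h c by (simp add: psubset_card_mono finite_dp_coef e)
  next
    case False
    then have "{b. dp_coef b f \<noteq> 0} = {a}" using less.prems by auto
    then have "f = dp_scale (dp_coef a f) (dp_monom a)" using dp_expand[of f] by simp
    then have "dp_scale (inverse (dp_coef a f)) f = dp_scale (inverse (dp_coef a f) * dp_coef a f) (dp_monom a)"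
      by (metis dp_const_mult dp_scale_def mult.assoc)
    then have "dp_monom a = dp_scale (inverse (dp_coef a f)) f"
      using less.prems by (simp add: dp_scale_one)
    then show ?thesis using gl_ideal_scale[OF P] less.prems by metis
  qed
qed

lemma dp_of_nat_mult: "of_nat n * f = dp_scale (of_nat n) f"
  by (simp add: dp_scale_def unital_hom_of_nat[OF unital_hom_dp_const])

lemma dp_monom_insert: "n \<notin> Poly_Mapping.keys a \<Longrightarrow> dp_monom a * dp_gen n t = dp_monom (a + Poly_Mapping.single n t)"
  by (subst dp_monom_add_disjoint) (auto simp: dp_monom_single)

text \<open>The transvection sends the monomial to a sum of terms whose exponents of
  \<open>x_n\<close> are distinct, because \<open>n\<close> does not occur in \<open>a\<close>;
  \<open>gl_ideal_monom\<close> then extracts each of them. Since \<open>j\<close> may occur in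
  \<open>a\<close>, a binomial coefficient can appear. If it vanishes in \<open>k\<close>, the
  product in the conclusion is zero, which is why the conclusion is a product and not a
  monomial.\<close>

lemma gl_ideal_move:
  fixes P :: "'k::alg_closed_field divpow set"
  assumes P: "gl_ideal P" and n: "n \<notin> Poly_Mapping.keys a" "j \<noteq> n"
    and f: "dp_monom a * dp_gen n t \<in> P" and s: "s \<le> t"
  shows "dp_monom a * dp_gen j (t - s) * dp_gen n s \<in> P"
proof -
  define N where "N = (\<lambda>u. exp_binom a (Poly_Mapping.single j (t - u)))"
  define e where "e = (\<lambda>u. a + Poly_Mapping.single j (t - u) + Poly_Mapping.single n u)"
  have t: "dp_monom a * dp_gen j (t - u) * dp_gen n u = dp_scale (of_nat (N u)) (dp_monom (e u) :: 'k divpow)" for u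
  proof -
    have "n \<notin> Poly_Mapping.keys (a + Poly_Mapping.single j (t - u))"
      using n by (auto simp: in_keys_iff lookup_add lookup_single when_def)
    then show ?thesis
      unfolding dp_monom_single[symmetric, of j] dp_monom_mult
      by (simp add: mult.assoc dp_monom_insert dp_of_nat_mult dp_scale_def e_def N_def)
  qed
  define F where "F = gl_act (elementary n j 1) (dp_monom a * dp_gen n t :: 'k divpow)"
  have "F = (\<Sum>u\<le>t. dp_monom a * dp_gen j (t - u) * dp_gen n u)"
    by (simp add: F_def gl_act_mult elementary_gen_transvection elementary_monom_other[OF n(1)]
        sum_distrib_left mult_ac)
  moreover have inj: "e s = e u \<longleftrightarrow> u = s" for u
  proof -
    have "Poly_Mapping.lookup (e u) n = u" for u
      using n by (simp add: e_def lookup_add lookup_single in_keys_iff)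
    then show ?thesis by metis
  qed
  ultimately have "dp_coef (e s) F = (\<Sum>u\<le>t. of_nat (N u) * (if u = s then 1 else 0))"
    by (simp add: t dp_coef_sum dp_coef_scale dp_coef_monom)
  also have "\<dots> = (\<Sum>u\<le>t. if u = s then of_nat (N s) else 0)"
    by (rule sum.cong) auto
  finally have c: "dp_coef (e s) F = of_nat (N s)" using s by simp
  have "F \<in> P"
    unfolding F_def using n by (intro gl_ideal_act[OF P elementary_GL f]) auto
  show ?thesis
  proof (cases "of_nat (N s) = (0 :: 'k)")
    case True
    then show ?thesis by (simp add: t dp_scale_def dp_const_zero gl_ideal_zero[OF P])
  next
    case False
    then show ?thesis
      unfolding t using c gl_ideal_monom[OF P \<open>F \<in> P\<close>] by (intro gl_ideal_scale[OF P]) simp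
  qed
qed

lemma exp_split:
  "\<exists>b. a = b + Poly_Mapping.single n (Poly_Mapping.lookup a n) \<and> n \<notin> Poly_Mapping.keys b
    \<and> (\<forall>i. i \<noteq> n \<longrightarrow> Poly_Mapping.lookup b i = Poly_Mapping.lookup a i)"
  for a :: "nat \<Rightarrow>\<^sub>0 nat"
proof (intro exI conjI)
  let ?b = "Poly_Mapping.update n 0 a"
  show "a = ?b + Poly_Mapping.single n (Poly_Mapping.lookup a n)"
    by (rule poly_mapping_eqI) (auto simp: lookup_add lookup_single lookup_update when_def)
qed (auto simp: lookup_update in_keys_iff)

section \<open>Binomial coefficients modulo a prime\<close>

text \<open>By absorption \<open>p ^ r\<close> divides \<open>a * (n choose a)\<close>; were the
  binomial prime to \<open>p\<close>, all of \<open>p ^ r\<close> would divide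
  \<open>a\<close>.\<close>

lemma prime_dvd_binomial:
  fixes p :: nat
  assumes p: "prime p" and n: "p ^ r dvd n" and a: "\<not> p ^ r dvd a"
  shows "p dvd n choose a"
proof (rule ccontr)
  assume c: "\<not> p dvd n choose a"
  have "a > 0" using a by (cases a) auto
  then have "a * (n choose a) = n * ((n - 1) choose (a - 1))" by (rule times_binomial_minus1_eq)
  then have "p ^ r dvd a * (n choose a)" using n by simp
  moreover have "coprime (p ^ r) (n choose a)"
    using p c by (simp add: prime_imp_coprime)
  ultimately show False using a by (simp add: coprime_dvd_mult_left_iff)
qed

text \<open>By Pascal's rule and \<open>prime_dvd_binomial\<close>, consecutive entries are opposite
  modulo \<open>p\<close>, starting from 1.\<close>

lemma prime_not_dvd_binomial_pred:
  fixes p :: nat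
  assumes p: "prime p" and n: "p ^ r dvd n" "n > 0" and j: "j < p ^ r"
  shows "\<not> p dvd (n - 1) choose j"
  using j
proof (induction j)
  case 0
  show ?case using p by (simp add: prime_nat_iff)
next
  case (Suc j)
  have "\<not> p ^ r dvd Suc j" using Suc.prems by (auto dest: dvd_imp_le)
  then have d: "p dvd n choose Suc j" by (rule prime_dvd_binomial[OF p n(1)])
  have "n choose Suc j = ((n - 1) choose j) + ((n - 1) choose Suc j)"
    using n(2) by (cases n) auto
  then show ?case using d Suc by (metis Suc_lessD dvd_add_left_iff)
qed

text \<open>A case of Lucas' theorem, by which the binomial is congruent to \<open>m\<close>.
  Absorption exhibits it as \<open>m\<close> times an entry covered by
  \<open>prime_not_dvd_binomial_pred\<close>.\<close>

lemma prime_not_dvd_binomial_power: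
  fixes p :: nat
  assumes p: "prime p" and m: "\<not> p dvd m"
  shows "\<not> p dvd (p ^ s * m) choose (p ^ s)"
proof -
  have m0: "m > 0" using m by (cases m) auto
  have p0: "p ^ s > 0" using p by (simp add: prime_gt_0_nat)
  have "p ^ s * ((p ^ s * m) choose p ^ s) = p ^ s * (m * ((p ^ s * m - 1) choose (p ^ s - 1)))"
    using times_binomial_minus1_eq[OF p0, of "p ^ s * m"] by (simp add: mult_ac)
  then have "(p ^ s * m) choose p ^ s = m * ((p ^ s * m - 1) choose (p ^ s - 1))"
    using p0 by (metis mult_cancel1 less_numeral_extra(3))
  moreover have "\<not> p dvd (p ^ s * m - 1) choose (p ^ s - 1)"
    using p p0 m0 by (intro prime_not_dvd_binomial_pred[of p s]) auto
  ultimately show ?thesis using m p by (simp add: prime_dvd_mult_iff)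
qed

section \<open>The ideals in terms of monomials\<close>

text \<open>Divisibility by \<open>p ^ n\<close> is expressed through \<open>multiplicity\<close> so
  that \<open>n\<close> may be infinite, in which case only the zero exponent remains. The
  restriction to the keys matters because \<open>multiplicity p 0\<close> is 0.\<close>

definition stable_exps :: "nat \<Rightarrow> enat \<Rightarrow> (nat \<Rightarrow>\<^sub>0 nat) set" where
  "stable_exps p n = {a. \<forall>i\<in>Poly_Mapping.keys a. n \<le> enat (multiplicity p (Poly_Mapping.lookup a i))}"

text \<open>The span of the divided monomials with unstable exponent: one description that replaces
  the three clauses of \<open>dp_ideal\<close>.\<close>

definition vanishing_ideal :: "nat \<Rightarrow> enat \<Rightarrow> 'k::field divpow set" where
  "vanishing_ideal p n = {f. \<forall>a\<in>stable_exps p n. dp_coef a f = 0}"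

locale char_p =
  fixes p :: nat and type :: "'k::alg_closed_field itself"
  assumes char: "CHAR('k) = p" and pos: "p > 0"
begin

lemma prime: "prime p"
  using char pos prime_CHAR_semidom[where 'a = 'k] by simp

lemma of_nat_eq_0: "of_nat n = (0 :: 'k) \<longleftrightarrow> p dvd n"
  using char by (simp add: of_nat_eq_0_iff_char_dvd)

lemma le_multiplicity: "x \<noteq> 0 \<Longrightarrow> r \<le> multiplicity p x \<longleftrightarrow> p ^ r dvd x"
  using prime by (intro power_dvd_iff_le_multiplicity[symmetric]) (auto simp: prime_nat_iff)

lemma stable_exps_enat: "a \<in> stable_exps p (enat r) \<longleftrightarrow> (\<forall>i. p ^ r dvd Poly_Mapping.lookup a i)"
proof -
  have "p ^ r dvd Poly_Mapping.lookup a i \<longleftrightarrow> (Poly_Mapping.lookup a i \<noteq> 0 \<longrightarrow> r \<le> multiplicity p (Poly_Mapping.lookup a i))" for i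
    using le_multiplicity by (cases "Poly_Mapping.lookup a i = 0") auto
  then show ?thesis by (auto simp: stable_exps_def in_keys_iff)
qed

lemma stable_exps_infinity: "a \<in> stable_exps p \<infinity> \<longleftrightarrow> a = 0"
  by (auto simp: stable_exps_def)

lemma stable_exps_zero: "0 \<in> stable_exps p n"
  by (simp add: stable_exps_def)

lemma stable_exps_add: "a \<in> stable_exps p n \<Longrightarrow> b \<in> stable_exps p n \<Longrightarrow> a + b \<in> stable_exps p n"
  by (cases n) (auto simp: stable_exps_enat stable_exps_infinity lookup_add)

lemma stable_exps_single:
  "t \<noteq> 0 \<Longrightarrow> Poly_Mapping.single i t \<in> stable_exps p n \<longleftrightarrow> n \<le> enat (multiplicity p t)"
  by (simp add: stable_exps_def)

lemma multiplicity_power: "multiplicity p (p ^ s) = s"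
  using prime by (simp add: prime_nat_iff multiplicity_same_power)

text \<open>Reduces every question about unstable monomials to the generators
  \<open>x_i^[p^s]\<close> with \<open>s < n\<close>. Here \<open>s\<close> is the exact
  multiplicity of an offending exponent, which makes the binomial coefficient invertible in
  \<open>k\<close>.\<close>

lemma unstable_monom:
  assumes "a \<notin> stable_exps p n"
  shows "\<exists>i s y. enat s < n \<and> (dp_monom a :: 'k divpow) = y * dp_gen i (p ^ s)"
proof -
  obtain i where i: "Poly_Mapping.lookup a i \<noteq> 0" "enat (multiplicity p (Poly_Mapping.lookup a i)) < n"
    using assms by (auto simp: stable_exps_def not_le in_keys_iff)
  define s t where "s = multiplicity p (Poly_Mapping.lookup a i)" and "t = Poly_Mapping.lookup a i"
  obtain m where m: "t = p ^ s * m" unfolding s_def t_def using multiplicity_dvd by blast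
  have "\<not> p ^ Suc s dvd t"
    using le_multiplicity[of t "Suc s"] i by (simp add: s_def t_def)
  then have pm: "\<not> p dvd m" using m pos by (auto simp: mult.commute)
  define c where "c = (t choose p ^ s)"
  have c: "of_nat c \<noteq> (0 :: 'k)"
    using prime_not_dvd_binomial_power[OF prime pm, of s] by (simp add: of_nat_eq_0 c_def m)
  have "p ^ s \<le> t" using m i by (cases m) (auto simp: t_def)
  then have "dp_gen i (t - p ^ s) * dp_gen i (p ^ s) = (dp_scale (of_nat c) (dp_gen i t) :: 'k divpow)"
    using dp_gen_mult[of i "t - p ^ s" "p ^ s", where 'k = 'k] by (simp add: c_def dp_of_nat_mult)
  then have "dp_scale (1 / of_nat c) (dp_gen i (t - p ^ s) * dp_gen i (p ^ s))
      = (dp_scale (1 / of_nat c) (dp_scale (of_nat c) (dp_gen i t)) :: 'k divpow)"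
    by (rule arg_cong)
  also have "\<dots> = dp_scale (1 / of_nat c * of_nat c) (dp_gen i t)"
    by (simp only: dp_scale_def dp_const_mult mult.assoc)
  also have "\<dots> = dp_gen i t" using c by (simp add: dp_scale_one)
  finally have g: "dp_gen i t = (dp_scale (1 / of_nat c) (dp_gen i (t - p ^ s)) * dp_gen i (p ^ s) :: 'k divpow)"
    by (simp only: dp_scale_def mult.assoc)
  obtain b where b: "a = b + Poly_Mapping.single i t" "i \<notin> Poly_Mapping.keys b"
    using exp_split[of a i] unfolding t_def by blast
  have "(dp_monom a :: 'k divpow)
      = (dp_monom b * dp_scale (1 / of_nat c) (dp_gen i (t - p ^ s))) * dp_gen i (p ^ s)"
    using dp_monom_insert[OF b(2), of t, where 'a = 'k] unfolding b(1)[symmetric] g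
    by (simp add: mult.assoc)
  then show ?thesis using i by (auto simp: s_def)
qed

lemma vanishing_monom: "(dp_monom a :: 'k divpow) \<in> vanishing_ideal p n \<longleftrightarrow> a \<notin> stable_exps p n"
  by (auto simp: vanishing_ideal_def dp_coef_monom split: if_splits)

text \<open>This makes \<open>vanishing_ideal\<close> an ideal: a product with an unstable factor
  can reach a stable exponent only with coefficient zero. If \<open>p ^ r\<close> divides an entry
  of the sum but not that of \<open>b\<close>, it does not divide that of \<open>a\<close> either,
  and \<open>prime_dvd_binomial\<close> applies.\<close>

lemma exp_binom_stable:
  assumes "a + b \<in> stable_exps p n" "b \<notin> stable_exps p n"
  shows "of_nat (exp_binom a b) = (0 :: 'k)"
proof (cases n)
  case (enat r)
  then obtain i where i: "\<not> p ^ r dvd Poly_Mapping.lookup b i"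
    "p ^ r dvd Poly_Mapping.lookup a i + Poly_Mapping.lookup b i"
    using assms by (auto simp: stable_exps_enat lookup_add)
  then have "\<not> p ^ r dvd Poly_Mapping.lookup a i" by (metis dvd_add_right_iff)
  then have "p dvd (Poly_Mapping.lookup a i + Poly_Mapping.lookup b i) choose Poly_Mapping.lookup a i"
    by (rule prime_dvd_binomial[OF prime i(2)])
  moreover have "i \<in> Poly_Mapping.keys a \<union> Poly_Mapping.keys b"
    using i by (auto simp: in_keys_iff intro: ccontr)
  ultimately show ?thesis
    unfolding of_nat_eq_0 exp_binom_def by (intro dvd_trans[OF _ dvd_prodI]) auto
next
  case infinity
  then have "b = 0" using assms(1) by (auto simp: stable_exps_infinity poly_mapping_eq_iff fun_eq_iff lookup_add)
  then show ?thesis using assms(2) by (simp add: stable_exps_zero)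
qed

lemma vanishing_add: "f \<in> vanishing_ideal p n \<Longrightarrow> g \<in> vanishing_ideal p n \<Longrightarrow> f + g \<in> vanishing_ideal p n"
  and vanishing_scale: "f \<in> vanishing_ideal p n \<Longrightarrow> dp_scale c f \<in> vanishing_ideal p n"
  and vanishing_zero: "0 \<in> vanishing_ideal p n"
  by (auto simp: vanishing_ideal_def dp_coef_add dp_coef_scale dp_coef_zero)

lemma vanishing_sum: "(\<And>x. x \<in> S \<Longrightarrow> F x \<in> vanishing_ideal p n) \<Longrightarrow> sum F S \<in> vanishing_ideal p n"
  by (induction S rule: infinite_finite_induct) (auto simp: vanishing_add vanishing_zero)

lemma vanishing_mult:
  assumes f: "f \<in> vanishing_ideal p n"
  shows "h * f \<in> (vanishing_ideal p n :: 'k divpow set)"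
proof -
  have m: "dp_scale c (dp_monom b) * dp_scale d (dp_monom a) \<in> (vanishing_ideal p n :: 'k divpow set)"
    if "a \<notin> stable_exps p n" for a b c d
  proof -
    have "dp_monom b * dp_monom a \<in> (vanishing_ideal p n :: 'k divpow set)"
      unfolding dp_monom_mult dp_of_nat_mult vanishing_ideal_def
      using exp_binom_stable[OF _ that] by (auto simp: dp_coef_scale dp_coef_monom)
    from vanishing_scale[OF vanishing_scale[OF this, of c], of d] show ?thesis
      by (simp add: dp_scale_def mult_ac)
  qed
  have "h * f = (\<Sum>b | dp_coef b h \<noteq> 0. \<Sum>a | dp_coef a f \<noteq> 0.
      dp_scale (dp_coef b h) (dp_monom b) * dp_scale (dp_coef a f) (dp_monom a))"
    by (subst dp_expand[of h], subst dp_expand[of f]) (simp add: sum_product)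
  also have "\<dots> \<in> vanishing_ideal p n"
    using f by (intro vanishing_sum m) (auto simp: vanishing_ideal_def)
  finally show ?thesis .
qed

text \<open>A nonzero stable exponent has a nonzero entry divisible by \<open>p ^ Suc s\<close>, so
  its degree exceeds \<open>d\<close>.\<close>

lemma vanishing_degree:
  assumes "f \<in> dp_degree_part d" "1 \<le> d" "d \<le> p ^ s" "enat s < n"
  shows "f \<in> vanishing_ideal p n"
  unfolding vanishing_ideal_def
proof (intro CollectI ballI, rule ccontr)
  fix a assume a: "a \<in> stable_exps p n" "dp_coef a f \<noteq> 0"
  then have d: "exp_degree a = d" using assms(1) dp_coef_degree_part by blast
  then have "a \<noteq> 0" using assms(2) exp_degree_eq_0[of a] by auto
  then obtain i where i: "Poly_Mapping.lookup a i \<noteq> 0" by (auto simp: poly_mapping_eq_iff fun_eq_iff)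
  then have "n \<le> enat (multiplicity p (Poly_Mapping.lookup a i))"
    using a by (auto simp: stable_exps_def in_keys_iff)
  then have "Suc s \<le> multiplicity p (Poly_Mapping.lookup a i)"
    using assms(4) by (metis Suc_leI enat_ord_simps(2) order_less_le_trans)
  then have "p ^ Suc s dvd Poly_Mapping.lookup a i" using le_multiplicity i by blast
  then have "p ^ Suc s \<le> d"
    using i lookup_le_exp_degree[of a i] d by (metis dvd_imp_le gr0I le_trans)
  moreover have "p ^ s < p ^ Suc s"
    using prime by (intro power_strict_increasing) (auto simp: prime_nat_iff)
  ultimately show False using assms(3) by linarith
qed

lemma vanishing_gen: "enat s < n \<Longrightarrow> dp_gen i (p ^ s) \<in> vanishing_ideal p n"
  using pos by (intro vanishing_degree[OF dp_degree_part_gen, of _ s]) auto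

lemma vanishing_coef: "f \<in> vanishing_ideal p n \<Longrightarrow> dp_coef a f \<noteq> 0 \<Longrightarrow> a \<notin> stable_exps p n"
  by (auto simp: vanishing_ideal_def)

text \<open>The action does not preserve monomials, but by \<open>unstable_monom\<close> only the
  image of a factor \<open>x_i^[p^s]\<close> matters. That image is homogeneous of degree
  \<open>p ^ s\<close>, so \<open>vanishing_degree\<close> applies whatever the matrix is.\<close>

lemma gl_ideal_vanishing: "gl_ideal (vanishing_ideal p n :: 'k divpow set)"
  unfolding gl_ideal_def ring_ideal_def
proof (intro conjI ballI allI image_subsetI vanishing_zero vanishing_add vanishing_mult)
  fix g f assume f: "f \<in> (vanishing_ideal p n :: 'k divpow set)"
  have "gl_act g (dp_monom a) \<in> (vanishing_ideal p n :: 'k divpow set)" if na: "a \<notin> stable_exps p n" for a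
  proof -
    obtain i s y where s: "enat s < n" "(dp_monom a :: 'k divpow) = y * dp_gen i (p ^ s)"
      using unstable_monom[OF na] by blast
    have "dp_power (g (vec_basis i)) (p ^ s) \<in> vanishing_ideal p n"
      by (rule vanishing_degree[OF dp_power_degree _ _ s(1)]) (use pos in auto)
    then show ?thesis by (simp add: s(2) gl_act_mult gl_act_gen_power vanishing_mult)
  qed
  then show "gl_act g f \<in> vanishing_ideal p n"
    using vanishing_coef[OF f]
    by (subst dp_expand[of f]) (auto simp: gl_act_sum gl_act_scale intro!: vanishing_sum vanishing_scale)
qed

lemma vanishing_subset:
  assumes P: "gl_ideal P"
    and s: "\<And>i s. enat s < n \<Longrightarrow> dp_gen i (p ^ s) \<in> P"
  shows "(vanishing_ideal p n :: 'k divpow set) \<subseteq> P"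
proof
  fix f :: "'k divpow" assume f: "f \<in> vanishing_ideal p n"
  show "f \<in> P"
  proof (rule gl_ideal_from_monoms[OF P])
    fix a assume "dp_coef a f \<noteq> 0"
    then show "dp_monom a \<in> P"
      using unstable_monom[OF vanishing_coef[OF f]] s gl_ideal_mult[OF P] by metis
  qed
qed

lemma dp_ideal_eq: "dp_ideal p n = (vanishing_ideal p n :: 'k divpow set)"
proof (cases n)
  case (enat r)
  show ?thesis
  proof (cases "r = 0")
    case True
    have "f = 0" if "f \<in> vanishing_ideal p (enat 0)" for f :: "'k divpow"
      using that by (subst dp_expand[of f]) (simp add: vanishing_ideal_def stable_exps_enat)
    then have "vanishing_ideal p (enat 0) = {0 :: 'k divpow}" using vanishing_zero by blast
    moreover have "dp_ideal p (enat 0) = {0 :: 'k divpow}" unfolding dp_ideal_def enat.case by simp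
    ultimately show ?thesis using enat True by simp
  next
    case False
    let ?D = "\<Union>d\<in>{1..p ^ (r - 1)}. dp_degree_part d :: 'k divpow set"
    have "?D \<subseteq> vanishing_ideal p n"
      using vanishing_degree[of _ _ "r - 1" n] enat False by fastforce
    then have "gl_ideal hull ?D \<subseteq> vanishing_ideal p n"
      by (rule hull_minimal) (rule gl_ideal_vanishing)
    moreover have "vanishing_ideal p n \<subseteq> gl_ideal hull ?D"
    proof (rule vanishing_subset[OF gl_ideal_hull])
      fix i s assume "enat s < n"
      then have "p ^ s \<le> p ^ (r - 1)" using pos enat by (intro power_increasing) auto
      moreover have "1 \<le> p ^ s" using pos by simp
      ultimately have "dp_gen i (p ^ s) \<in> ?D" using dp_degree_part_gen by fastforce
      then show "dp_gen i (p ^ s) \<in> gl_ideal hull ?D" by (rule hull_inc)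
    qed
    ultimately show ?thesis using enat False by (auto simp: dp_ideal_def)
  qed
next
  case infinity
  interpret module "dp_scale :: 'k \<Rightarrow> _" by (rule module_dp_scale)
  let ?D = "\<Union>d\<in>{1..}. dp_degree_part d :: 'k divpow set"
  \<comment> \<open>At infinity every \<open>s\<close> is admissible in
    \<open>vanishing_degree\<close>; \<open>s = d\<close> is large enough.\<close>
  have "d \<le> p ^ d" for d
    using power_gt_expt[of p d] prime_gt_1_nat[OF prime] by simp
  then have "?D \<subseteq> vanishing_ideal p n"
    using vanishing_degree[of _ _ _ n] infinity by fastforce
  moreover have "subspace (vanishing_ideal p n)"
    by (auto simp: subspace_def vanishing_zero vanishing_add vanishing_scale)
  ultimately have "span ?D \<subseteq> vanishing_ideal p n" by (rule span_minimal)
  moreover have "f \<in> span ?D" if f: "f \<in> vanishing_ideal p n" for f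
  proof (subst dp_expand[of f], intro span_sum span_scale)
    fix a assume "a \<in> {a. dp_coef a f \<noteq> 0}"
    then have "a \<noteq> 0" using vanishing_coef[OF f] stable_exps_zero by blast
    then have "1 \<le> exp_degree a" using exp_degree_eq_0[of a] by linarith
    then show "dp_monom a \<in> span ?D" using dp_degree_part_monom by (intro span_base) auto
  qed
  ultimately show ?thesis using infinity by (auto simp: dp_ideal_def)
qed

lemma vanishing_subset_iff:
  "(vanishing_ideal p m :: 'k divpow set) \<subseteq> vanishing_ideal p n \<longleftrightarrow> m \<le> n"
proof
  assume "m \<le> n"
  then have "stable_exps p n \<subseteq> stable_exps p m" by (auto simp: stable_exps_def intro: order_trans)
  then show "(vanishing_ideal p m :: 'k divpow set) \<subseteq> vanishing_ideal p n"
    by (auto simp: vanishing_ideal_def)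
next
  assume s: "(vanishing_ideal p m :: 'k divpow set) \<subseteq> vanishing_ideal p n"
  show "m \<le> n"
  proof (rule ccontr)
    assume "\<not> m \<le> n"
    then obtain r where r: "n = enat r" "enat r < m" by (cases n) auto
    \<comment> \<open>The witness \<open>x_0^[p^r]\<close> has multiplicity exactly
      \<open>r\<close>, so it lies in the ideal of every index above \<open>r\<close> and not in
      that of \<open>r\<close>.\<close>
    have e: "Poly_Mapping.single 0 (p ^ r) \<in> stable_exps p k \<longleftrightarrow> k \<le> enat r" for k
      using pos by (subst stable_exps_single) (auto simp: multiplicity_power)
    have "(dp_monom (Poly_Mapping.single 0 (p ^ r)) :: 'k divpow) \<in> vanishing_ideal p m"
      using r by (simp add: vanishing_monom e not_le)
    then have "(dp_monom (Poly_Mapping.single 0 (p ^ r)) :: 'k divpow) \<in> vanishing_ideal p n"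
      using s by blast
    then show False using r by (simp add: vanishing_monom e)
  qed
qed

section \<open>The equivariant primes\<close>

text \<open>A shared variable is replaced by a fresh one, moving its whole exponent by
  \<open>gl_ideal_move\<close> with \<open>s = 0\<close>. The nonzero exponents stay the same up to
  relabelling, hence stable, and the overlap with \<open>a\<close> shrinks. Fresh variables exist
  because there are infinitely many.\<close>

lemma gl_ideal_disjoint_monom:
  assumes J: "gl_ideal J" and b: "b \<in> stable_exps p n" "(dp_monom b :: 'k divpow) \<in> J"
  shows "\<exists>b'\<in>stable_exps p n. dp_monom b' \<in> J \<and> Poly_Mapping.keys a \<inter> Poly_Mapping.keys b' = {}"
  using b
proof (induction "card (Poly_Mapping.keys a \<inter> Poly_Mapping.keys b)" arbitrary: b rule: less_induct)
  case less
  show ?case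
  proof (cases "Poly_Mapping.keys a \<inter> Poly_Mapping.keys b = {}")
    case True
    then show ?thesis using less.prems by blast
  next
    case False
    then obtain i where i: "i \<in> Poly_Mapping.keys a" "i \<in> Poly_Mapping.keys b" by blast
    define t where "t = Poly_Mapping.lookup b i"
    obtain c where c: "b = c + Poly_Mapping.single i t" "i \<notin> Poly_Mapping.keys c"
        "\<And>k. k \<noteq> i \<Longrightarrow> Poly_Mapping.lookup c k = Poly_Mapping.lookup b k"
      using exp_split[of b i] unfolding t_def by blast
    obtain j where j: "j \<notin> Poly_Mapping.keys a \<union> Poly_Mapping.keys b"
      using ex_new_if_finite[OF infinite_UNIV_nat, of "Poly_Mapping.keys a \<union> Poly_Mapping.keys b"] by auto
    have ji: "j \<noteq> i" using i j by auto
    have jc: "j \<notin> Poly_Mapping.keys c" using j c(3)[OF ji] by (auto simp: in_keys_iff)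
    have "dp_monom c * dp_gen i t \<in> J"
      using less.prems c by (simp add: dp_monom_insert)
    from gl_ideal_move[OF J c(2) ji this, of 0] have m: "dp_monom (c + Poly_Mapping.single j t) \<in> J"
      using jc by (simp add: dp_gen_0 dp_monom_insert)
    have kc: "k \<in> Poly_Mapping.keys c \<longleftrightarrow> k \<in> Poly_Mapping.keys b \<and> k \<noteq> i" for k
      using c(2) c(3)[of k] by (cases "k = i") (auto simp: in_keys_iff)
    then have "c \<in> stable_exps p n"
      using less.prems(1) c(3) by (auto simp: stable_exps_def)
    moreover have "Poly_Mapping.single j t \<in> stable_exps p n"
      using less.prems(1) i(2) by (auto simp: stable_exps_def t_def)
    ultimately have st: "c + Poly_Mapping.single j t \<in> stable_exps p n" by (rule stable_exps_add)
    have "Poly_Mapping.keys a \<inter> Poly_Mapping.keys (c + Poly_Mapping.single j t)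
        \<subset> Poly_Mapping.keys a \<inter> Poly_Mapping.keys b"
      using i j ji kc Poly_Mapping.keys_add[of c "Poly_Mapping.single j t"]
      by (auto split: if_splits)
    then have "card (Poly_Mapping.keys a \<inter> Poly_Mapping.keys (c + Poly_Mapping.single j t))
        < card (Poly_Mapping.keys a \<inter> Poly_Mapping.keys b)"
      by (intro psubset_card_mono) auto
    from less.hyps[OF this st m] show ?thesis .
  qed
qed

lemma gl_prime_vanishing: "gl_prime (vanishing_ideal p n :: 'k divpow set)"
  unfolding gl_prime_def
proof (intro conjI allI impI gl_ideal_vanishing)
  have "(dp_monom 0 :: 'k divpow) \<notin> vanishing_ideal p n"
    unfolding vanishing_monom by (simp add: stable_exps_zero)
  then show "(vanishing_ideal p n :: 'k divpow set) \<noteq> UNIV" by blast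
next
  fix I J :: "'k divpow set"
  assume I: "gl_ideal I" and J: "gl_ideal J"
    and IJ: "ideal_gen {x * y |x y. x \<in> I \<and> y \<in> J} \<subseteq> vanishing_ideal p n"
  have monom: "\<exists>a\<in>stable_exps p n. dp_monom a \<in> I" if "gl_ideal I" "\<not> I \<subseteq> vanishing_ideal p n"
    for I :: "'k divpow set"
    using that gl_ideal_monom[OF that(1)] by (fastforce simp: vanishing_ideal_def)
  show "I \<subseteq> vanishing_ideal p n \<or> J \<subseteq> vanishing_ideal p n"
  proof (rule ccontr)
    assume "\<not> ?thesis"
    then obtain a b where ab: "a \<in> stable_exps p n" "dp_monom a \<in> I" "b \<in> stable_exps p n" "dp_monom b \<in> J"
      using monom[OF I] monom[OF J] by blast
    obtain b' where b': "b' \<in> stable_exps p n" "dp_monom b' \<in> J"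
        "Poly_Mapping.keys a \<inter> Poly_Mapping.keys b' = {}"
      using gl_ideal_disjoint_monom[OF J ab(3,4)] by blast
    have "dp_monom a * dp_monom b' \<in> ideal_gen {x * y |x y. x \<in> I \<and> y \<in> J}"
      using ab b' by (intro ideal_gen_base) blast
    then have "dp_monom (a + b') \<in> (vanishing_ideal p n :: 'k divpow set)"
      using IJ dp_monom_add_disjoint[OF b'(3), where 'a = 'k] by auto
    then show False using stable_exps_add[OF ab(1) b'(1)] by (simp add: vanishing_monom)
  qed
qed

text \<open>Primality speaks of stable ideals only; this version tests a single element against one.
  The colon ideal of \<open>P\<close> by \<open>J\<close> is stable since
  \<open>g u * v = g (u * g^-1 v)\<close> and \<open>J\<close> is stable, and its product with
  \<open>J\<close> lies in \<open>P\<close>.\<close>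

lemma gl_prime_colon:
  fixes P J :: "'k divpow set"
  assumes P: "gl_prime P" and J: "gl_ideal J" and f: "\<And>v. v \<in> J \<Longrightarrow> f * v \<in> P"
  shows "f \<in> P \<or> J \<subseteq> P"
proof -
  have PI: "gl_ideal P" using P by (simp add: gl_prime_def)
  define I where "I = {u. \<forall>v\<in>J. u * v \<in> P}"
  have "gl_ideal I"
    unfolding gl_ideal_def ring_ideal_def
  proof (intro conjI ballI allI image_subsetI)
    fix g :: "'k vec \<Rightarrow> 'k vec" and u assume g: "g \<in> GL" and u: "u \<in> I"
    have "gl_act g u * v \<in> P" if v: "v \<in> J" for v
    proof -
      have "u * gl_act (inv g) v \<in> P"
        using u gl_ideal_act[OF J GL_inv[OF g] v] by (simp add: I_def)
      then have "gl_act g (u * gl_act (inv g) v) \<in> P" by (rule gl_ideal_act[OF PI g])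
      then show ?thesis by (simp add: gl_act_mult gl_act_inv[OF g])
    qed
    then show "gl_act g u \<in> I" by (simp add: I_def)
  qed (auto simp: I_def gl_ideal_zero[OF PI] gl_ideal_add[OF PI] gl_ideal_mult[OF PI] distrib_right mult.assoc)
  moreover have "ideal_gen {x * y |x y. x \<in> I \<and> y \<in> J} \<subseteq> P"
    using PI by (intro ideal_gen_minimal) (auto simp: I_def gl_ideal_def)
  ultimately have "I \<subseteq> P \<or> J \<subseteq> P" using P J unfolding gl_prime_def by blast
  moreover have "f \<in> I" using f by (simp add: I_def)
  ultimately show ?thesis by blast
qed

text \<open>Splitting \<open>x\<^sub>n\<^bsup>[p\<^sup>r]\<^esup>\<close> with a fresh variable off a monomial in \<open>P\<close>, the remaining factor multiplies
  every \<open>x\<^sub>j\<^bsup>[p\<^sup>r]\<^esup>\<close>, hence the next ideal, into \<open>P\<close>, so primality lowers the degree.\<close>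

lemma gl_prime_step:
  assumes P: "gl_prime P" and r: "vanishing_ideal p (enat r) \<subseteq> P"
    and a: "a \<in> stable_exps p (enat r)" "(dp_monom a :: 'k divpow) \<in> P"
  shows "vanishing_ideal p (enat (Suc r)) \<subseteq> P"
  using a
proof (induction "exp_degree a" arbitrary: a rule: less_induct)
  case less
  have PI: "gl_ideal P" and proper: "P \<noteq> UNIV" using P by (auto simp: gl_prime_def)
  \<comment> \<open>The descent on the degree cannot end at the zero exponent.\<close>
  have "1 \<notin> P" using proper gl_ideal_mult[OF PI, of 1] by auto
  then have "a \<noteq> 0" using less.prems by (auto simp: dp_monom_zero)
  then obtain i where i: "Poly_Mapping.lookup a i \<noteq> 0" by (auto simp: poly_mapping_eq_iff fun_eq_iff)
  define t where "t = Poly_Mapping.lookup a i"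
  define q where "q = p ^ r"
  have qt: "q dvd t" "t \<noteq> 0" using less.prems i by (auto simp: stable_exps_enat t_def q_def)
  then have "q \<le> t" by (auto dest: dvd_imp_le)
  have "q > 0" using pos by (simp add: q_def)
  obtain c where c: "a = c + Poly_Mapping.single i t" "i \<notin> Poly_Mapping.keys c"
      "\<And>k. k \<noteq> i \<Longrightarrow> Poly_Mapping.lookup c k = Poly_Mapping.lookup a k"
    using exp_split[of a i] unfolding t_def by blast
  obtain n where n: "n \<notin> insert i (Poly_Mapping.keys c)"
    using ex_new_if_finite[OF infinite_UNIV_nat, of "insert i (Poly_Mapping.keys c)"] by auto
  \<comment> \<open>The exponent of \<open>x_i\<close> drops by \<open>q\<close>, which keeps it
    divisible by \<open>q\<close> and lowers the degree.\<close>
  define b where "b = c + Poly_Mapping.single i (t - q)"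
  have nb: "n \<notin> Poly_Mapping.keys b"
    using n by (auto simp: b_def in_keys_iff lookup_add lookup_single)
  have "dp_monom c * dp_gen i t \<in> P" using less.prems c by (simp add: dp_monom_insert)
  from gl_ideal_move[OF PI c(2) _ this, of n "t - q"] n \<open>q \<le> t\<close>
  have "dp_monom c * dp_gen n q * dp_gen i (t - q) \<in> P" by simp
  then have bn: "dp_monom b * dp_gen n q \<in> P"
    using c(2) by (simp add: b_def dp_monom_insert[symmetric] mult_ac)
  \<comment> \<open>Since \<open>n\<close> does not occur in \<open>b\<close>, the factor
    \<open>x_n^[q]\<close> can be carried over to any \<open>j\<close>, including variables of
    \<open>b\<close>.\<close>
  have bj: "dp_monom b * dp_gen j q \<in> P" for j
    using gl_ideal_move[OF PI nb _ bn, of j 0] bn by (cases "j = n") (auto simp: dp_gen_0)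
  have J: "dp_monom b * v \<in> P" if v: "v \<in> vanishing_ideal p (enat (Suc r))" for v
  proof -
    have "dp_monom b * dp_monom e \<in> P" if e: "e \<notin> stable_exps p (enat (Suc r))" for e
    proof -
      obtain j s y where s: "s < Suc r" "(dp_monom e :: 'k divpow) = y * dp_gen j (p ^ s)"
        using unstable_monom[OF e] by auto
      have "dp_monom b * dp_gen j (p ^ s) \<in> P"
      \<comment> \<open>Only the generators with \<open>s = r\<close> are new; those of lower order
        already lie in \<open>P\<close> by the assumption \<open>r\<close>.\<close>
      proof (cases "s = r")
        case True
        then show ?thesis using bj by (simp add: q_def)
      next
        case False
        then have "dp_gen j (p ^ s) \<in> vanishing_ideal p (enat r)"
          using s by (intro vanishing_gen) simp
        then show ?thesis using r gl_ideal_mult[OF PI] by blast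
      qed
      then have "y * (dp_monom b * dp_gen j (p ^ s)) \<in> P" by (rule gl_ideal_mult[OF PI])
      then show ?thesis by (simp add: s(2) mult_ac)
    qed
    then have "dp_scale d (dp_monom b * dp_monom e) \<in> P" if "e \<notin> stable_exps p (enat (Suc r))" for d e
      using that gl_ideal_scale[OF PI] by blast
    moreover have "dp_monom b * dp_scale d (dp_monom e) = dp_scale d (dp_monom b * dp_monom e :: 'k divpow)" for d e
      by (simp add: dp_scale_def mult_ac)
    ultimately show ?thesis
      using vanishing_coef[OF v]
      by (subst dp_expand[of v]) (auto simp: sum_distrib_left intro!: gl_ideal_sum[OF PI])
  qed
  show ?case
  proof (cases "dp_monom b \<in> P")
    case True
    have "exp_degree b < exp_degree a"
      using \<open>q \<le> t\<close> \<open>q > 0\<close> by (simp add: b_def c(1) exp_degree_add exp_degree_single)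
    moreover have "b \<in> stable_exps p (enat r)"
      unfolding stable_exps_enat
    proof
      fix k
      show "p ^ r dvd Poly_Mapping.lookup b k"
        using less.prems(1) c(2) c(3)[of k] qt
        by (cases "k = i")
          (auto simp: b_def lookup_add lookup_single when_def stable_exps_enat q_def in_keys_iff)
    qed
    ultimately show ?thesis using less.hyps True by blast
  next
    case False
    then show ?thesis using gl_prime_colon[OF P gl_ideal_vanishing J] by blast
  qed
qed

text \<open>Either \<open>P\<close> contains the whole chain of ideals of finite index, hence the
  maximal ideal, and being proper equals it; or some \<open>k\<close> is the last index before the
  chain leaves \<open>P\<close>, and by \<open>gl_prime_step\<close> a monomial of \<open>P\<close>
  outside that ideal would force the next one into \<open>P\<close>.\<close>

lemma gl_prime_iff: "gl_prime P \<longleftrightarrow> (\<exists>n. P = (vanishing_ideal p n :: 'k divpow set))"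
proof
  assume P: "gl_prime P"
  then have PI: "gl_ideal P" by (simp add: gl_prime_def)
  show "\<exists>n. P = vanishing_ideal p n"
  proof (cases "\<forall>r. vanishing_ideal p (enat r) \<subseteq> P")
    case True
    have "dp_gen i (p ^ s) \<in> P" for i s
    proof -
      have "dp_gen i (p ^ s) \<in> vanishing_ideal p (enat (Suc s))"
        by (rule vanishing_gen) simp
      then show ?thesis using True by blast
    qed
    then have "vanishing_ideal p \<infinity> \<subseteq> P" by (intro vanishing_subset[OF PI])
    moreover have "f \<in> vanishing_ideal p \<infinity>" if "f \<in> P" for f
    proof (rule ccontr)
      assume "f \<notin> vanishing_ideal p \<infinity>"
      then have "dp_coef 0 f \<noteq> 0" by (auto simp: vanishing_ideal_def stable_exps_infinity)
      then have "1 \<in> P" using gl_ideal_monom[OF PI that] by (metis dp_monom_zero)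
      then have "P = UNIV" using gl_ideal_mult[OF PI, of 1] by auto
      then show False using P by (simp add: gl_prime_def)
    qed
    ultimately show ?thesis by blast
  next
    case False
    have z: "vanishing_ideal p (enat 0) \<subseteq> P"
      by (rule vanishing_subset[OF PI]) (auto simp: zero_enat_def[symmetric])
    have "\<exists>k. vanishing_ideal p (enat k) \<subseteq> P \<and> \<not> vanishing_ideal p (enat (Suc k)) \<subseteq> P"
    proof (rule ccontr)
      assume n: "\<not> ?thesis"
      have "vanishing_ideal p (enat r) \<subseteq> P" for r
        by (induction r) (use z n in blast)+
      then show False using False by blast
    qed
    then obtain k where s: "vanishing_ideal p (enat k) \<subseteq> P"
        and r: "\<not> vanishing_ideal p (enat (Suc k)) \<subseteq> P" by blast
    have "f \<in> vanishing_ideal p (enat k)" if "f \<in> P" for f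
    proof (rule ccontr)
      assume "f \<notin> vanishing_ideal p (enat k)"
      then obtain a where "a \<in> stable_exps p (enat k)" "dp_coef a f \<noteq> 0" by (auto simp: vanishing_ideal_def)
      then show False using gl_prime_step[OF P s] gl_ideal_monom[OF PI that] r by blast
    qed
    then show ?thesis using s by blast
  qed
qed (auto simp: gl_prime_vanishing)

section \<open>The homeomorphism\<close>

lemma homeomorphic_dp_ideal: "homeomorphic_map right_order (gl_spec :: 'k divpow set topology) (dp_ideal p)"
proof -
  let ?V = "vanishing_ideal p :: enat \<Rightarrow> 'k divpow set"
  have V: "dp_ideal p = ?V" by (rule ext) (rule dp_ideal_eq)
  have "closedin right_order UNIV"
    unfolding closedin_right_order by (intro disjI2 exI[of _ 0]) (simp add: atLeast_def)
  then have tr: "topspace right_order = UNIV" using closedin_subset by blast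
  have "?V 0 \<subseteq> ?V n" for n by (simp add: vanishing_subset_iff)
  then have "{P :: 'k divpow set. gl_prime P} = {P. gl_prime P \<and> ?V 0 \<subseteq> P}"
    by (auto simp: gl_prime_iff)
  then have "closedin gl_spec {P :: 'k divpow set. gl_prime P}"
    unfolding closedin_gl_spec using gl_ideal_vanishing by blast
  moreover have "topspace gl_spec \<subseteq> {P :: 'k divpow set. gl_prime P}"
    using closedin_topspace[of "gl_spec :: 'k divpow set topology"] unfolding closedin_gl_spec by blast
  ultimately have ts: "topspace gl_spec = {P :: 'k divpow set. gl_prime P}"
    using closedin_subset by blast
  \<comment> \<open>By the well-order of \<open>enat\<close> a nonempty up-set has a least element,
    so it is one of the closed intervals. Continuity then needs only that the ideals grow with the
    index.\<close>
  have up: "closedin right_order C" if "\<And>m n. m \<in> C \<Longrightarrow> m \<le> n \<Longrightarrow> n \<in> C" for C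
  proof (cases "C = {}")
    case False
    then obtain x where "x \<in> C" by blast
    then have "(LEAST x. x \<in> C) \<in> C" by (rule LeastI)
    then have "C = {(LEAST x. x \<in> C)..}" using that Least_le[of "\<lambda>x. x \<in> C"] by blast
    then show ?thesis unfolding closedin_right_order by blast
  qed (simp add: closedin_right_order)
  show ?thesis
    unfolding V
  proof (rule bijective_closed_imp_homeomorphic_map)
    show "continuous_map right_order gl_spec ?V"
      unfolding continuous_map_closedin
    proof (intro conjI allI impI ballI)
      fix C :: "'k divpow set set" assume "closedin gl_spec C"
      then obtain I where C: "C = {P. gl_prime P \<and> I \<subseteq> P}" unfolding closedin_gl_spec by blast
      then show "closedin right_order {x \<in> topspace right_order. ?V x \<in> C}"
        by (intro up) (simp add: C gl_prime_vanishing tr, meson subset_trans vanishing_subset_iff)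
    qed (auto simp: ts gl_prime_vanishing)
    show "closed_map right_order gl_spec ?V"
      unfolding closed_map_def
    proof (intro allI impI)
      fix C :: "enat set" assume "closedin right_order C"
      then consider "C = {}" | n where "C = {n..}" unfolding closedin_right_order by blast
      then show "closedin gl_spec (?V ` C)"
      proof cases
        case (2 n)
        then have "?V ` C = {P. gl_prime P \<and> ?V n \<subseteq> P}"
          unfolding gl_prime_iff using vanishing_subset_iff by (auto simp: image_iff)
        then show ?thesis unfolding closedin_gl_spec using gl_ideal_vanishing by blast
      qed simp
    qed
    show "?V ` topspace right_order = topspace gl_spec"
      unfolding tr ts gl_prime_iff by blast
    show "inj_on ?V (topspace right_order)"
    proof (rule inj_onI)
      fix m n assume "?V m = ?V n"
      then show "m = n"
        using vanishing_subset_iff[of m n] vanishing_subset_iff[of n m] by simp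
    qed
  qed
qed

end

theorem theorem1:
  fixes p :: nat
  assumes "CHAR('k::alg_closed_field) = p" and "p > 0"
  shows "homeomorphic_map right_order (gl_spec :: 'k divpow set topology) (dp_ideal p)"
proof -
  interpret char_p p "TYPE('k)" using assms by unfold_locales
  show ?thesis by (rule homeomorphic_dp_ideal)
qed

end
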